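(* For any $\alpha\ge0$, the operator $\mathbb{W}_*^\alpha$ is bounded from $\mathcal{H}^1((0,\infty),\gamma_\alpha)$ into $L^1((0,\infty),\gamma_\alpha)$.
   Context: For $\alpha>-\frac12$, $\gamma_\alpha$ is the probability measure on $(0,\infty)$ given by $d\gamma_\alpha(x)=\frac{2x^{2\alpha+1}}{\Gamma(\alpha+1)}e^{-x^2}dx$. For $x,r>0$, $I(x,r):=(x-r,x+r)\cap(0,\infty)$. Put $m(x)=\min\{1,1/x\}$ for $x>0$. For $a>0$, $\mathcal{B}_a$ is the class of intervals $I(x,r)$ with $0<r\le x$ and $r\le a\,m(x)$. Atoms: for $1<q\le\infty$ and $a>0$, a measurable function $b$ on $(0,\infty)$ is an $(a,q,\alpha)$-atom when either $b(x)=1$ for every $x\in(0,\infty)$, or there exist $0<r\le x$ with $I(x,r)\in\mathcal{B}_a$ such that (i) $\mathrm{supp}(b)\subset I(x,r)$; (ii) $\|b\|_{L^q((0,\infty),\gamma_\alpha)}\le\gamma_\alpha(I(x,r))^{\frac1q-1}$ (with $\frac1q=0$ if $q=\infty$); (iii) $\int_0^\infty b\,d\gamma_\alpha=0$. Hardy space: $\mathcal{H}^{1,q}_a((0,\infty),\gamma_\alpha)$ consists of all $f\in L^1((0,\infty),\gamma_\alpha)$ such that $f=\sum_{j=0}^\infty\lambda_jb_j$ (convergence in $L^1((0,\infty),\gamma_\alpha)$), where each $b_j$ is an $(a,q,\alpha)$-atom and $\lambda_j\in\mathbb{C}$ with $\sum_j|\lambda_j|<\infty$; its norm is the infimum of $\sum_j|\lambda_j|$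 over all such representations. These spaces do not depend on $a>0$ and $1<q\le\infty$ (with equivalent norms), and $\mathcal{H}^1((0,\infty),\gamma_\alpha)$ denotes any of them, e.g. $\mathcal{H}^{1,\infty}_1((0,\infty),\gamma_\alpha)$. Laguerre heat semigroup: for $t>0$ and $f\in L^p((0,\infty),\gamma_\alpha)$, $1\le p<\infty$, $$W_t^\alpha(f)(x)=\int_0^\infty W_t^\alpha(x,y)f(y)\,d\gamma_\alpha(y),\quad x\in(0,\infty),$$ where $$W_t^\alpha(x,y)=\frac{\Gamma(\alpha+1)}{1-e^{-t}}(e^{-t/2}xy)^{-\alpha}I_\alpha\left(\frac{2e^{-t/2}xy}{1-e^{-t}}\right)\exp\left(-\frac{e^{-t}}{1-e^{-t}}(x^2+y^2)\right),\quad x,y,t>0,$$ and $I_\alpha$ is the modified Bessel function of the first kind of order $\alpha$. (The integral is absolutely convergent, and $\{W_t^\alpha\}_{t>0}$ is the semigroup generated by $-\Delta_\alpha$, where $\Delta_\alpha$ is the self-adjoint extension, diagonalized by the Laguerre polynomials $L_k^\alpha(x^2)$, of $-\frac14\left(\frac{d^2}{dx^2}+\left(\frac{2\alpha+1}{x}-2x\right)\frac{d}{dx}\right)$ on $L^2((0,\infty),\gamma_\alpha)$.) The truncated maximal operator is $$\mathbb{W}_*^\alpha(f)(x)=\sup_{0<t<m(x)^2}|W_t^\alpha(f)(x)|,\quad x\in(0,\infty).$$ *)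

theory Defs
  imports "HOL-Probability.Probability"
begin

text \<open>All functions live on \<open>(0, \<infinity>)\<close>, represented by total functions on \<^typ>\<open>real\<close>; the measure space
  \<open>gamma_measure \<alpha>\<close> has space \<open>{0<..}\<close>, so values at nonpositive arguments are never seen.\<close>

definition gamma_measure :: "real \<Rightarrow> real measure" where
  "gamma_measure \<alpha> =
     density (restrict_space lborel {0<..})
       (\<lambda>x. ennreal (2 * x powr (2 * \<alpha> + 1) / Gamma (\<alpha> + 1) * exp (- x\<^sup>2)))"

definition pos_interval :: "real \<Rightarrow> real \<Rightarrow> real set" where
  "pos_interval x r = {x - r<..<x + r} \<inter> {0<..}"

definition m_fun :: "real \<Rightarrow> real" where
  "m_fun x = min 1 (1 / x)"

definition admissible_ball :: "real \<Rightarrow> real \<Rightarrow> real \<Rightarrow> bool" where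
  "admissible_ball a x r \<longleftrightarrow> 0 < r \<and> r \<le> x \<and> r \<le> a * m_fun x"

text \<open>The \<open>L\<^sup>q\<close> norm with values in \<open>[0, \<infinity>]\<close>, meant for measurable \<open>f\<close> and \<open>1 \<le> q \<le> \<infinity>\<close>.
  The inner conditional only supplies \<open>\<infinity>\<close> to the power \<open>1/q\<close>, as \<open>powr\<close> is not
  available on \<^typ>\<open>ennreal\<close>.\<close>

definition Lq_norm :: "'a measure \<Rightarrow> ennreal \<Rightarrow> ('a \<Rightarrow> complex) \<Rightarrow> ennreal" where
  "Lq_norm M q f =
     (if q = \<infinity> then esssup M (\<lambda>x. ennreal (norm (f x)))
      else (let N = (\<integral>\<^sup>+ x. ennreal (norm (f x) powr enn2real q) \<partial>M)
            in if N = \<infinity> then \<infinity> else ennreal (enn2real N powr (1 / enn2real q))))"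

text \<open>Atoms, for \<open>a > 0\<close> and \<open>1 < q \<le> \<infinity>\<close>. In the exponent, \<open>1 / q = 0\<close> when \<open>q = \<infinity>\<close>.
  The support condition says that \<open>b\<close> vanishes on \<open>(0, \<infinity>)\<close> outside the (open) interval.\<close>

definition is_atom :: "real \<Rightarrow> ennreal \<Rightarrow> real \<Rightarrow> (real \<Rightarrow> complex) \<Rightarrow> bool" where
  "is_atom a q \<alpha> b \<longleftrightarrow>
     b \<in> borel_measurable (gamma_measure \<alpha>) \<and>
     ((\<forall>x>0. b x = 1) \<or>
      (\<exists>x r. admissible_ball a x r \<and>
         {y. 0 < y \<and> b y \<noteq> 0} \<subseteq> pos_interval x r \<and>
         Lq_norm (gamma_measure \<alpha>) q b
           \<le> ennreal (measure (gamma_measure \<alpha>) (pos_interval x r) powr (enn2real (1 / q) - 1)) \<and>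
         (\<integral>y. b y \<partial>gamma_measure \<alpha>) = 0))"

definition atomic_rep ::
    "real \<Rightarrow> ennreal \<Rightarrow> real \<Rightarrow> (real \<Rightarrow> complex) \<Rightarrow> (nat \<Rightarrow> complex) \<Rightarrow> (nat \<Rightarrow> real \<Rightarrow> complex) \<Rightarrow> bool" where
  "atomic_rep a q \<alpha> f c b \<longleftrightarrow>
     (\<forall>j. is_atom a q \<alpha> (b j)) \<and>
     summable (\<lambda>j. norm (c j)) \<and>
     ((\<lambda>n. \<integral>\<^sup>+ x. ennreal (norm (f x - (\<Sum>j<n. c j * b j x))) \<partial>gamma_measure \<alpha>) \<longlonglongrightarrow> 0)"

definition hardy_space_aq :: "real \<Rightarrow> ennreal \<Rightarrow> real \<Rightarrow> (real \<Rightarrow> complex) set" where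
  "hardy_space_aq a q \<alpha> = {f. integrable (gamma_measure \<alpha>) f \<and> (\<exists>c b. atomic_rep a q \<alpha> f c b)}"

definition hardy_norm_aq :: "real \<Rightarrow> ennreal \<Rightarrow> real \<Rightarrow> (real \<Rightarrow> complex) \<Rightarrow> real" where
  "hardy_norm_aq a q \<alpha> f = Inf {(\<Sum>j. norm (c j)) | c. \<exists>b. atomic_rep a q \<alpha> f c b}"

text \<open>The spaces for different \<open>a > 0\<close> and \<open>1 < q \<le> \<infinity>\<close> coincide with equivalent norms;
  \<open>a = 1\<close> and \<open>q = \<infinity>\<close> is taken as the representative.\<close>

definition hardy_space :: "real \<Rightarrow> (real \<Rightarrow> complex) set" where
  "hardy_space = hardy_space_aq 1 \<infinity>"

definition hardy_norm :: "real \<Rightarrow> (real \<Rightarrow> complex) \<Rightarrow> real" where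
  "hardy_norm = hardy_norm_aq 1 \<infinity>"

text \<open>Modified Bessel function of the first kind, for \<open>z > 0\<close> and \<open>\<nu> > -1\<close>, by its power series.\<close>

definition bessel_I :: "real \<Rightarrow> real \<Rightarrow> real" where
  "bessel_I \<nu> z = (\<Sum>k. (z / 2) powr (2 * real k + \<nu>) / (fact k * Gamma (real k + \<nu> + 1)))"

definition laguerre_kernel :: "real \<Rightarrow> real \<Rightarrow> real \<Rightarrow> real \<Rightarrow> real" where
  "laguerre_kernel \<alpha> t x y =
     Gamma (\<alpha> + 1) / (1 - exp (- t)) * (exp (- t / 2) * x * y) powr (- \<alpha>)
     * bessel_I \<alpha> (2 * exp (- t / 2) * x * y / (1 - exp (- t)))
     * exp (- (exp (- t) / (1 - exp (- t))) * (x\<^sup>2 + y\<^sup>2))"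

definition laguerre_semigroup :: "real \<Rightarrow> real \<Rightarrow> (real \<Rightarrow> complex) \<Rightarrow> real \<Rightarrow> complex" where
  "laguerre_semigroup \<alpha> t f x =
     (\<integral>y. complex_of_real (laguerre_kernel \<alpha> t x y) * f y \<partial>gamma_measure \<alpha>)"

definition truncated_maximal :: "real \<Rightarrow> (real \<Rightarrow> complex) \<Rightarrow> real \<Rightarrow> ennreal" where
  "truncated_maximal \<alpha> f x =
     (\<Squnion>t\<in>{0<..<(m_fun x)\<^sup>2}. ennreal (norm (laguerre_semigroup \<alpha> t f x)))"

end

theory Submission
  imports Defs
begin

text \<open>Up to the factor \<open>exp (x\<^sup>2)\<close>, which cancels the Gaussian weight in \<open>\<gamma>\<close>, the Laguerre kernel
  \<open>W\<^sub>t(x, y)\<close> is a Bessel heat kernel at time \<open>\<tau> = 1 - exp (- t)\<close> evaluated at \<open>(x, exp (- t / 2) y)\<close>.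
  Multiplied by \<open>x powr (2 \<alpha> + 1)\<close>, this heat kernel and its \<open>y\<close>-derivative are dominated by their
  one-dimensional Gaussian counterparts; this follows from two-sided bounds on \<open>I\<^sub>\<alpha>\<^sub>+\<^sub>1 / I\<^sub>\<alpha>\<close>, which are
  comparison arguments for the Bessel equation. The restriction \<open>t < m(x)\<^sup>2\<close> makes the dilation by
  \<open>exp (- t / 2)\<close> a shift of \<open>x\<close> of size at most \<open>O(\<surd>t)\<close>, hence harmless. For an atom on \<open>I(x\<^sub>0, r)\<close> the
  maximal function is bounded near the interval by its size together with local doubling of \<open>\<gamma>\<close>, and for
  \<open>\<bar>x - x\<^sub>0\<bar> \<ge> 2 r\<close> cancellation gives the integrable bound \<open>r / (x - x\<^sub>0)\<^sup>2\<close> with respect to Lebesgue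
  measure. General \<open>f\<close> follow because \<open>W\<^sub>t(x, \<cdot>)\<close> is bounded, so \<open>W\<^sub>t f(x)\<close> may be computed
  termwise from an atomic decomposition.\<close>

section \<open>Ratio bounds for modified Bessel functions\<close>

text \<open>For \<nu> \<ge> 0 this is \<open>bessel_I\<close> without its factor
  \<open>(z / 2) powr \<nu>\<close>, in the variable \<open>w = (z / 2)\<^sup>2\<close>: an entire
  function, positive for \<open>w \<ge> 0\<close>, whose derivative merely raises the order.\<close>

definition bes :: "real \<Rightarrow> real \<Rightarrow> real" where
  "bes \<nu> w = (\<Sum>k. inverse (fact k * Gamma (real k + \<nu> + 1)) * w ^ k)"

section \<open>The power series of \<open>bes\<close>: convergence, positivity, derivative,
  recurrence\<close>

lemma Gamma_plus1_real:
  fixes x :: real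
  assumes "x > 0"
  shows "Gamma (x + 1) = x * Gamma x"
  using assms by (intro Gamma_plus1) (auto elim!: nonpos_Ints_cases)

lemma Gamma_le_shift:
  fixes \<nu> :: real
  assumes "\<nu> \<ge> 0"
  shows "Gamma (\<nu> + 1) \<le> Gamma (real k + \<nu> + 1)"
proof (induction k)
  case (Suc k)
  have *: "Gamma (real (Suc k) + \<nu> + 1) = (real k + \<nu> + 1) * Gamma (real k + \<nu> + 1)"
    using assms Gamma_plus1_real[of "real k + \<nu> + 1"] by (simp add: add_ac)
  have "1 * Gamma (real k + \<nu> + 1) \<le> (real k + \<nu> + 1) * Gamma (real k + \<nu> + 1)"
    using assms by (intro mult_right_mono) auto
  with Suc * show ?case by linarith
qed auto

text \<open>For \<nu> \<ge> 0 the Gamma factors never drop below \<open>Gamma (\<nu> + 1)\<close>,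
  so the exponential series is a majorant.\<close>

lemma summable_bes:
  assumes "\<nu> \<ge> 0"
  shows "summable (\<lambda>k. inverse (fact k * Gamma (real k + \<nu> + 1)) * w ^ k)"
proof (rule summable_comparison_test')
  show "summable (\<lambda>k. inverse (Gamma (\<nu> + 1)) * (inverse (fact k) * \<bar>w\<bar> ^ k))"
    by (intro summable_mult summable_exp)
  show "norm (inverse (fact k * Gamma (real k + \<nu> + 1)) * w ^ k)
        \<le> inverse (Gamma (\<nu> + 1)) * (inverse (fact k) * \<bar>w\<bar> ^ k)" for k
  proof -
    have "inverse (Gamma (real k + \<nu> + 1)) \<le> inverse (Gamma (\<nu> + 1))"
      using Gamma_le_shift[OF assms, of k] assms by (intro le_imp_inverse_le Gamma_real_pos) auto
    moreover have "Gamma (real k + \<nu> + 1) > 0"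
      using assms by (intro Gamma_real_pos) auto
    ultimately show ?thesis
      using mult_right_mono[of "inverse (Gamma (real k + \<nu> + 1))" "inverse (Gamma (\<nu> + 1))" "inverse (fact k) * \<bar>w\<bar> ^ k"]
      by (simp add: abs_mult power_abs mult_ac)
  qed
qed

lemma bes_0 [simp]: "bes \<nu> 0 = inverse (Gamma (\<nu> + 1))"
  by (simp add: bes_def)

lemma bes_pos:
  assumes "\<nu> \<ge> 0" "w \<ge> 0"
  shows "bes \<nu> w > 0"
  unfolding bes_def
proof (rule suminf_pos2[OF summable_bes[OF assms(1)], of _ 0])
  show "0 \<le> inverse (fact k * Gamma (real k + \<nu> + 1)) * w ^ k" for k
    using assms by (intro mult_nonneg_nonneg) (auto intro!: mult_nonneg_nonneg less_imp_le[OF Gamma_real_pos])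
  show "0 < inverse (fact 0 * Gamma (real 0 + \<nu> + 1)) * w ^ 0"
    using assms by (auto intro!: Gamma_real_pos)
qed

lemma bes_coeff_Suc:
  "real (Suc k) * inverse (fact (Suc k) * Gamma (real (Suc k) + \<nu> + 1)) =
     inverse (fact k * Gamma (real k + (\<nu> + 1) + 1))"
proof -
  have "real (Suc k) + \<nu> + 1 = real k + (\<nu> + 1) + 1"
    by simp
  then show ?thesis
    by (simp only: fact_Suc inverse_mult_distrib of_nat_mult) (simp del: of_nat_Suc)
qed

lemma has_real_derivative_bes:
  assumes "\<nu> \<ge> 0"
  shows "(bes \<nu> has_real_derivative bes (\<nu> + 1) w) (at w)"
proof -
  let ?c = "\<lambda>\<nu> k. inverse (fact k * Gamma (real k + \<nu> + 1))"
  have "diffs (?c \<nu>) = ?c (\<nu> + 1)"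
  proof
    fix k
    show "diffs (?c \<nu>) k = ?c (\<nu> + 1) k"
      unfolding diffs_def by (rule bes_coeff_Suc)
  qed
  then show ?thesis
    using termdiffs_strong_converges_everywhere[of "?c \<nu>" w] summable_bes[OF assms]
    by (simp add: bes_def[abs_def])
qed

text \<open>Coefficientwise this is the functional equation of Gamma, which leaves a factor
  \<open>real k\<close> that an index shift absorbs. It is the three-term recurrence of the Bessel
  functions and serves to eliminate the order \<open>\<nu> + 2\<close> from the derivative of order
  \<open>\<nu> + 1\<close>.\<close>

lemma bes_recurrence:
  assumes "\<nu> \<ge> 0"
  shows "bes \<nu> w = w * bes (\<nu> + 2) w + (\<nu> + 1) * bes (\<nu> + 1) w"
proof -
  let ?c = "\<lambda>\<nu> k. inverse (fact k * Gamma (real k + \<nu> + 1))"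
  have c: "?c \<nu> k - (\<nu> + 1) * ?c (\<nu> + 1) k = real k * ?c (\<nu> + 1) k" for k
  proof -
    have "Gamma (real k + (\<nu> + 1) + 1) = (real k + \<nu> + 1) * Gamma (real k + \<nu> + 1)"
      using assms Gamma_plus1_real[of "real k + \<nu> + 1"] by (simp add: add_ac)
    moreover have "Gamma (real k + \<nu> + 1) > 0" "real k + \<nu> + 1 > 0"
      using assms by (auto intro!: Gamma_real_pos)
    ultimately show ?thesis by (simp add: divide_simps)
  qed
  have s: "summable (\<lambda>k. ?c \<nu> k * w ^ k)" "summable (\<lambda>k. ?c (\<nu> + 1) k * w ^ k)"
     "summable (\<lambda>k. ?c (\<nu> + 2) k * w ^ k)"
    using assms by (intro summable_bes; simp)+
  have "bes \<nu> w - (\<nu> + 1) * bes (\<nu> + 1) w = (\<Sum>k. ?c \<nu> k * w ^ k - (\<nu> + 1) * (?c (\<nu> + 1) k * w ^ k))"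
    unfolding bes_def
    using suminf_diff[OF s(1) summable_mult[OF s(2), of "\<nu> + 1"]] suminf_mult[OF s(2), of "\<nu> + 1"]
    by linarith
  also have "\<dots> = (\<Sum>k. real k * ?c (\<nu> + 1) k * w ^ k)"
    by (intro suminf_cong) (simp only: c[symmetric], simp add: algebra_simps)
  \<comment> \<open>The term \<open>k = 0\<close> vanishes, so nothing is lost by starting at
    \<open>Suc k\<close>.\<close>
  also have "\<dots> = (\<Sum>k. real (Suc k) * ?c (\<nu> + 1) (Suc k) * w ^ Suc k)"
  proof -
    have "summable (\<lambda>k. real k * ?c (\<nu> + 1) k * w ^ k)"
      unfolding c[symmetric] using s by (auto simp: algebra_simps intro!: summable_diff summable_add summable_mult)
    from suminf_split_head[OF this] show ?thesis by simp
  qed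
  also have "\<dots> = (\<Sum>k. w * (?c (\<nu> + 2) k * w ^ k))"
    unfolding bes_coeff_Suc by (intro suminf_cong) (simp add: add_ac)
  also have "\<dots> = w * bes (\<nu> + 2) w"
    unfolding bes_def using s by (simp add: suminf_mult)
  finally show ?thesis by simp
qed

lemma bessel_I_eq_bes:
  assumes "\<nu> \<ge> 0" "z > 0"
  shows "bessel_I \<nu> z = (z / 2) powr \<nu> * bes \<nu> ((z / 2)\<^sup>2)"
proof -
  have "bessel_I \<nu> z = (\<Sum>k. (z / 2) powr \<nu> * (inverse (fact k * Gamma (real k + \<nu> + 1)) * ((z / 2)\<^sup>2) ^ k))"
    unfolding bessel_I_def
  proof (rule suminf_cong)
    fix k
    have "(z / 2) powr (2 * real k + \<nu>) = (z / 2) powr \<nu> * (z / 2) powr real (2 * k)"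
      by (simp add: powr_add)
    also have "(z / 2) powr real (2 * k) = ((z / 2)\<^sup>2) ^ k"
      using assms by (simp only: powr_realpow power_mult)
    finally have "(z / 2) powr (2 * real k + \<nu>) = (z / 2) powr \<nu> * ((z / 2)\<^sup>2) ^ k" .
    then show "(z / 2) powr (2 * real k + \<nu>) / (fact k * Gamma (real k + \<nu> + 1)) =
        (z / 2) powr \<nu> * (inverse (fact k * Gamma (real k + \<nu> + 1)) * ((z / 2)\<^sup>2) ^ k)"
      by (simp only: divide_inverse[of _ "fact k * _"] mult_ac)
  qed
  then show ?thesis
    unfolding bes_def using summable_bes[OF assms(1)] by (simp add: suminf_mult)
qed

lemma has_real_derivative_bes_sq:
  assumes "\<nu> \<ge> 0"
  shows "((\<lambda>z. bes \<nu> ((z / 2)\<^sup>2)) has_real_derivative z / 2 * bes (\<nu> + 1) ((z / 2)\<^sup>2)) (at z)"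
  by (rule DERIV_cong, rule DERIV_chain2[OF has_real_derivative_bes[OF assms]])
     (auto intro!: derivative_eq_intros)

text \<open>Together with \<open>has_real_derivative_bes_sq\<close> this is the Bessel equation as a
  closed first-order system for the orders \<open>\<nu>\<close> and \<open>\<nu> + 1\<close>; the
  recurrence has replaced the order \<open>\<nu> + 2\<close>.\<close>

lemma has_real_derivative_bes_sq':
  assumes "\<nu> \<ge> 0" "z > 0"
  shows "((\<lambda>z. bes (\<nu> + 1) ((z / 2)\<^sup>2)) has_real_derivative
           2 / z * (bes \<nu> ((z / 2)\<^sup>2) - (\<nu> + 1) * bes (\<nu> + 1) ((z / 2)\<^sup>2))) (at z)"
  by (rule DERIV_cong, rule has_real_derivative_bes_sq)
     (use assms bes_recurrence[OF assms(1), of "(z / 2)\<^sup>2"] in \<open>auto simp: field_simps power2_eq_square\<close>)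

section \<open>Comparison principle, and bounds for the quotient of consecutive orders\<close>

lemma powr_eq_mult_powr_minus1:
  fixes x :: real
  assumes "x > 0"
  shows "x powr s = x * x powr (s - 1)"
  using assms by (simp add: powr_mult_base)

lemma nonneg_of_weighted_deriv_nonneg:
  fixes f w :: "real \<Rightarrow> real"
  assumes "0 \<le> z" "0 < s"
    and cont: "continuous_on {0..} f"
    and der: "\<And>u. u > 0 \<Longrightarrow> \<exists>f'. (f has_real_derivative f') (at u) \<and> u * f' + (u + s) * f u \<ge> 0"
    and "f 0 \<ge> 0"
  shows "f z \<ge> 0"
proof (cases "z = 0")
  \<comment> \<open>\<open>u powr s * exp u\<close> is the integrating factor of \<open>f' + (1 + s / u) f\<close>.\<close>
  case False
  let ?g = "\<lambda>u. u powr s * exp u * f u"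
  have "?g 0 \<le> ?g z"
  proof (rule DERIV_nonneg_imp_increasing_open[OF assms(1)])
    show "continuous_on {0..z} ?g"
      using \<open>0 < s\<close> by (intro continuous_intros continuous_on_powr' continuous_on_subset[OF cont]) auto
    fix u assume u: "0 < u" "u < z"
    obtain f' where f': "(f has_real_derivative f') (at u)" "u * f' + (u + s) * f u \<ge> 0"
      using der u by blast
    have "(?g has_real_derivative (u powr (s - 1) * exp u * (u * f' + (u + s) * f u))) (at u)"
    proof (rule DERIV_cong)
      show "(?g has_real_derivative (s * u powr (s - 1) * exp u + u powr s * exp u) * f u + u powr s * exp u * f') (at u)"
        by (rule derivative_eq_intros has_real_derivative_powr f'(1) refl | use u in simp)+
      have "u powr s = u * u powr (s - 1)"
        by (rule powr_eq_mult_powr_minus1[OF u(1)])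
      then show "(s * u powr (s - 1) * exp u + u powr s * exp u) * f u + u powr s * exp u * f' =
          u powr (s - 1) * exp u * (u * f' + (u + s) * f u)"
        by (simp add: algebra_simps)
    qed
    then show "\<exists>y. (?g has_real_derivative y) (at u) \<and> 0 \<le> y"
      using f'(2) u by (intro exI[of _ "u powr (s - 1) * exp u * (u * f' + (u + s) * f u)"]) simp
  qed
  \<comment> \<open>As \<open>s > 0\<close>, \<open>0 powr s\<close> is 0 and \<open>?g 0\<close>
    vanishes; the growth of \<open>?g\<close> thus gives \<open>?g z \<ge> 0\<close>, and the
    positive weight can be divided out.\<close>
  moreover have "z powr s * exp z > 0"
    using False by simp
  ultimately show ?thesis
    using \<open>0 < s\<close> by (simp add: zero_le_mult_iff)
qed (use assms in simp)

lemma continuous_on_bes_sq: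
  assumes "\<nu> \<ge> 0"
  shows "continuous_on S (\<lambda>z. bes \<nu> ((z / 2)\<^sup>2))"
  by (rule DERIV_continuous_on[OF DERIV_subset[OF has_real_derivative_bes_sq[OF assms]]]) auto

text \<open>With the weight exponent \<open>\<nu> + 1/2\<close> the terms in \<open>?A\<close> and
  all powers of \<open>u\<close> cancel in the weighted derivative inequality, leaving a nonnegative
  constant times \<open>?B\<close>. In classical form: I_{\<nu>+1}(z) / I_\<nu>(z) \<le> z / (z +
  \<nu> + 1/2).\<close>

lemma bes_ratio_upper:
  assumes "\<nu> \<ge> 0" "z \<ge> 0"
  shows "(z + \<nu> + 1/2) / 2 * bes (\<nu> + 1) ((z / 2)\<^sup>2) \<le> bes \<nu> ((z / 2)\<^sup>2)"
proof -
  let ?A = "\<lambda>z. bes \<nu> ((z / 2)\<^sup>2)" and ?B = "\<lambda>z. bes (\<nu> + 1) ((z / 2)\<^sup>2)"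
  let ?f = "\<lambda>z. ?A z - (z + \<nu> + 1/2) / 2 * ?B z"
  have "?f z \<ge> 0"
  proof (rule nonneg_of_weighted_deriv_nonneg[where f = ?f and z = z and s = "\<nu> + 1/2"])
    show "continuous_on {0..} ?f"
      using assms by (intro continuous_intros continuous_on_bes_sq) auto
    have "Gamma (\<nu> + 2) = (\<nu> + 1) * Gamma (\<nu> + 1)"
      using assms Gamma_plus1_real[of "\<nu> + 1"] by (simp add: add_ac)
    moreover obtain G where "Gamma (\<nu> + 1) = G" "G > 0"
      using assms by (auto intro!: Gamma_real_pos)
    ultimately show "?f 0 \<ge> 0"
      using assms by (simp add: add_ac divide_simps)
    fix u :: real assume u: "u > 0"
    let ?f' = "u / 2 * ?B u - (1 / 2 * ?B u + (u + \<nu> + 1/2) / 2 * (2 / u * (?A u - (\<nu> + 1) * ?B u)))"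
    have lin: "((\<lambda>z. (z + \<nu> + 1/2) / 2) has_real_derivative 1 / 2) (at u)"
      by (auto intro!: derivative_eq_intros)
    have der: "(?f has_real_derivative ?f') (at u)"
      by (rule DERIV_cong[OF DERIV_diff[OF has_real_derivative_bes_sq[OF assms(1)]
          DERIV_mult[OF lin has_real_derivative_bes_sq'[OF assms(1) u]]]]) (simp only: mult_ac)
    have "u * ?f' + (u + (\<nu> + 1/2)) * ?f u = ((\<nu> + 1/2)\<^sup>2 + (\<nu> + 1/2)) / 2 * ?B u"
      using u by (simp add: field_simps power2_eq_square)
    moreover have "\<dots> \<ge> 0"
      using assms bes_pos[of "\<nu> + 1" "(u / 2)\<^sup>2"] by (intro mult_nonneg_nonneg) auto
    ultimately have "u * ?f' + (u + (\<nu> + 1/2)) * ?f u \<ge> 0"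
      by (simp only:)
    with der show "\<exists>f'. (?f has_real_derivative f') (at u) \<and> u * f' + (u + (\<nu> + 1/2)) * ?f u \<ge> 0"
      by (intro exI[of _ ?f'] conjI)
  qed (use assms in auto)
  then show ?thesis by simp
qed

text \<open>The same comparison for a difference of opposite sign: the weight exponent
  \<open>2 * \<nu> + 2\<close> again removes \<open>?A\<close>, and both sides agree at 0. In
  classical form: I_{\<nu>+1}(z) / I_\<nu>(z) \<ge> z / (z + 2 \<nu> + 2).\<close>

lemma bes_ratio_lower:
  assumes "\<nu> \<ge> 0" "z \<ge> 0"
  shows "bes \<nu> ((z / 2)\<^sup>2) \<le> (z + 2 * \<nu> + 2) / 2 * bes (\<nu> + 1) ((z / 2)\<^sup>2)"
proof -
  let ?A = "\<lambda>z. bes \<nu> ((z / 2)\<^sup>2)" and ?B = "\<lambda>z. bes (\<nu> + 1) ((z / 2)\<^sup>2)"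
  let ?f = "\<lambda>z. (z + 2 * \<nu> + 2) / 2 * ?B z - ?A z"
  have "?f z \<ge> 0"
  proof (rule nonneg_of_weighted_deriv_nonneg[where f = ?f and z = z and s = "2 * \<nu> + 2"])
    show "continuous_on {0..} ?f"
      using assms by (intro continuous_intros continuous_on_bes_sq) auto
    have "Gamma (\<nu> + 2) = (\<nu> + 1) * Gamma (\<nu> + 1)"
      using assms Gamma_plus1_real[of "\<nu> + 1"] by (simp add: add_ac)
    moreover obtain G where "Gamma (\<nu> + 1) = G" "G > 0"
      using assms by (auto intro!: Gamma_real_pos)
    ultimately show "?f 0 \<ge> 0"
      using assms by (simp add: add_ac divide_simps)
    fix u :: real assume u: "u > 0"
    let ?f' = "1 / 2 * ?B u + (u + 2 * \<nu> + 2) / 2 * (2 / u * (?A u - (\<nu> + 1) * ?B u)) - u / 2 * ?B u"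
    have lin: "((\<lambda>z. (z + 2 * \<nu> + 2) / 2) has_real_derivative 1 / 2) (at u)"
      by (auto intro!: derivative_eq_intros)
    have der: "(?f has_real_derivative ?f') (at u)"
      by (rule DERIV_cong[OF DERIV_diff[OF DERIV_mult[OF lin has_real_derivative_bes_sq'[OF assms(1) u]]
          has_real_derivative_bes_sq[OF assms(1)]]]) (simp only: mult_ac)
    have "u * ?f' + (u + (2 * \<nu> + 2)) * ?f u = u * (\<nu> + 3/2) * ?B u"
      using u by (simp add: field_simps power2_eq_square)
    moreover have "\<dots> \<ge> 0"
      using assms u bes_pos[of "\<nu> + 1" "(u / 2)\<^sup>2"] by (intro mult_nonneg_nonneg) auto
    ultimately have "u * ?f' + (u + (2 * \<nu> + 2)) * ?f u \<ge> 0"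
      by (simp only:)
    with der show "\<exists>f'. (?f has_real_derivative f') (at u) \<and> u * f' + (u + (2 * \<nu> + 2)) * ?f u \<ge> 0"
      by (intro exI[of _ ?f'] conjI)
  qed (use assms in auto)
  then show ?thesis by simp
qed

text \<open>The upper ratio bound says that the logarithmic derivative of \<open>?A\<close> is at
  most \<open>1 - d / (z + d)\<close> with \<open>d = \<nu> + 1/2\<close>. Hence \<open>?g\<close>
  is nonincreasing, and its value at 0 is the constant. With the factor
  \<open>(z / 2) powr \<nu>\<close> restored, this is growth of I_\<nu>(z) at most like exp z / sqrt
  z.\<close>

lemma bes_le_exp_powr:
  assumes "\<nu> \<ge> 0" "z \<ge> 0"
  shows "(z + \<nu> + 1/2) powr (\<nu> + 1/2) * bes \<nu> ((z / 2)\<^sup>2)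
           \<le> (\<nu> + 1/2) powr (\<nu> + 1/2) / Gamma (\<nu> + 1) * exp z"
proof -
  let ?d = "\<nu> + 1/2"
  let ?A = "\<lambda>z. bes \<nu> ((z / 2)\<^sup>2)" and ?B = "\<lambda>z. bes (\<nu> + 1) ((z / 2)\<^sup>2)"
  let ?g = "\<lambda>u. (u + ?d) powr ?d * exp (- u) * ?A u"
  have "?g z \<le> ?g 0"
  proof (rule DERIV_nonpos_imp_nonincreasing[OF assms(2)])
    fix u assume u: "0 \<le> u" "u \<le> z"
    have lin: "((\<lambda>u. (u + ?d) powr ?d * exp (- u)) has_real_derivative
        ?d * (u + ?d) powr (?d - 1) * exp (- u) - (u + ?d) powr ?d * exp (- u)) (at u)"
      using u assms by (auto intro!: derivative_eq_intros)
    have der: "(?g has_real_derivative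
        (?d * (u + ?d) powr (?d - 1) * exp (- u) - (u + ?d) powr ?d * exp (- u)) * ?A u
         + (u + ?d) powr ?d * exp (- u) * (u / 2 * ?B u)) (at u)"
      by (rule DERIV_cong[OF DERIV_mult[OF lin has_real_derivative_bes_sq[OF assms(1)]]]) simp
    have *: "(?d * (u + ?d) powr (?d - 1) * exp (- u) - (u + ?d) powr ?d * exp (- u)) * ?A u
         + (u + ?d) powr ?d * exp (- u) * (u / 2 * ?B u)
        = (u + ?d) powr (?d - 1) * exp (- u) * u * ((u + \<nu> + 1/2) / 2 * ?B u - ?A u)"
    proof -
      have **: "(u + ?d) powr ?d = (u + ?d) * (u + ?d) powr (?d - 1)"
        using u assms by (intro powr_eq_mult_powr_minus1) auto
      have gen: "(d * P * E - (u + d) * P * E) * A + (u + d) * P * E * (u / 2 * B)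
          = P * E * u * ((u + d) / 2 * B - A)" for d P E A B :: real
        by (simp add: field_simps)
      show ?thesis unfolding ** gen by (simp only: add.assoc)
    qed
    have "(u + ?d) powr (?d - 1) * exp (- u) * u * ((u + \<nu> + 1/2) / 2 * ?B u - ?A u) \<le> 0"
      using u bes_ratio_upper[OF assms(1), of u] by (intro mult_nonneg_nonpos) auto
    with der show "\<exists>y. (?g has_real_derivative y) (at u) \<and> y \<le> 0"
      unfolding * by (intro exI conjI)
  qed
  then show ?thesis
    by (simp add: exp_minus field_simps)
qed

section \<open>The Bessel heat kernel\<close>

text \<open>For positive arguments this equals \<open>(x * y) powr (- \<nu>) / \<tau> * bessel_I
  \<nu> (2 * x * y / \<tau>) * exp (- (x\<^sup>2 + y\<^sup>2) / \<tau>)\<close>, the heat kernel of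
  the Bessel operator up to normalisation. Going through \<open>bes\<close> keeps it differentiable
  in \<open>y\<close> across \<open>y = 0\<close>.\<close>

definition heat :: "real \<Rightarrow> real \<Rightarrow> real \<Rightarrow> real \<Rightarrow> real" where
  "heat \<nu> \<tau> x y = \<tau> powr (- (\<nu> + 1)) * bes \<nu> ((x * y / \<tau>)\<^sup>2) * exp (- (x\<^sup>2 + y\<^sup>2) / \<tau>)"

section \<open>Identification with the Laguerre kernel, and Gaussian upper bounds\<close>

lemma heat_commute: "heat \<nu> \<tau> x y = heat \<nu> \<tau> y x"
  by (simp add: heat_def mult.commute add.commute)

lemma heat_nonneg: "\<nu> \<ge> 0 \<Longrightarrow> heat \<nu> \<tau> x y \<ge> 0"
  unfolding heat_def by (intro mult_nonneg_nonneg less_imp_le[OF bes_pos]) auto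

text \<open>With \<open>\<rho> = exp (- t / 2)\<close> one has
  \<open>\<rho>\<^sup>2 = 1 - \<tau>\<close>, so
  \<open>- \<rho>\<^sup>2 * x\<^sup>2 / \<tau>\<close> is
  \<open>x\<^sup>2 - x\<^sup>2 / \<tau>\<close>. This splits off \<open>exp (x\<^sup>2)\<close> and
  leaves a Gaussian in \<open>x\<close> and \<open>\<rho> * y\<close>; the powers of
  \<open>\<rho> * x * y\<close> cancel.\<close>

lemma laguerre_kernel_eq_heat:
  assumes "\<nu> \<ge> 0" "t > 0" "x > 0" "y > 0"
  shows "laguerre_kernel \<nu> t x y = Gamma (\<nu> + 1) * exp (x\<^sup>2) * heat \<nu> (1 - exp (- t)) x (exp (- t / 2) * y)"
proof -
  define \<rho> where "\<rho> = exp (- t / 2)"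
  define \<tau> where "\<tau> = 1 - exp (- t)"
  have \<rho>: "\<rho> > 0" and \<tau>: "\<tau> > 0"
    using assms by (auto simp: \<rho>_def \<tau>_def)
  have \<rho>2: "exp (- t) = \<rho>\<^sup>2" "\<rho>\<^sup>2 = 1 - \<tau>"
    by (auto simp: \<rho>_def \<tau>_def exp_double[symmetric])
  define z where "z = 2 * \<rho> * x * y / \<tau>"
  have z: "z > 0" "z / 2 = x * (\<rho> * y) / \<tau>"
    using \<rho> \<tau> assms by (auto simp: z_def)
  have "laguerre_kernel \<nu> t x y = Gamma (\<nu> + 1) / \<tau> * (\<rho> * x * y) powr (- \<nu>) * bessel_I \<nu> z * exp (- (\<rho>\<^sup>2 / \<tau>) * (x\<^sup>2 + y\<^sup>2))"
    unfolding laguerre_kernel_def \<rho>2(1)[symmetric] by (simp add: \<rho>_def \<tau>_def z_def)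
  also have "bessel_I \<nu> z = (z / 2) powr \<nu> * bes \<nu> ((x * (\<rho> * y) / \<tau>)\<^sup>2)"
    using bessel_I_eq_bes[OF assms(1) z(1)] z(2) by simp
  also have "(z / 2) powr \<nu> = (\<rho> * x * y) powr \<nu> * \<tau> powr (- \<nu>)"
    using \<rho> \<tau> assms unfolding z(2) by (simp add: powr_divide powr_minus powr_mult field_simps)
  also have "exp (- (\<rho>\<^sup>2 / \<tau>) * (x\<^sup>2 + y\<^sup>2)) = exp (x\<^sup>2) * exp (- (x\<^sup>2 + (\<rho> * y)\<^sup>2) / \<tau>)"
    unfolding exp_add[symmetric] power_mult_distrib \<rho>2(2) using \<tau> by (simp add: field_simps)
  also have "Gamma (\<nu> + 1) / \<tau> * (\<rho> * x * y) powr - \<nu> *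
      ((\<rho> * x * y) powr \<nu> * \<tau> powr (- \<nu>) * bes \<nu> ((x * (\<rho> * y) / \<tau>)\<^sup>2)) *
      (exp (x\<^sup>2) * exp (- (x\<^sup>2 + (\<rho> * y)\<^sup>2) / \<tau>)) =
      Gamma (\<nu> + 1) * exp (x\<^sup>2) * (((\<rho> * x * y) powr - \<nu> * (\<rho> * x * y) powr \<nu>) *
        (\<tau> powr (- \<nu>) / \<tau>) * bes \<nu> ((x * (\<rho> * y) / \<tau>)\<^sup>2) * exp (- (x\<^sup>2 + (\<rho> * y)\<^sup>2) / \<tau>))"
    by (simp only: divide_inverse mult_ac)
  also have "(\<rho> * x * y) powr - \<nu> * (\<rho> * x * y) powr \<nu> = 1"
    using \<rho> assms by (simp add: powr_minus field_simps)
  also have "\<tau> powr (- \<nu>) / \<tau> = \<tau> powr (- (\<nu> + 1))"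
    using \<tau> by (simp add: powr_diff)
  finally show ?thesis
    by (simp add: heat_def \<rho>_def \<tau>_def)
qed

text \<open>By symmetry of the kernel the dilation can act on \<open>x\<close> and the exponential
  on \<open>y\<close>. This form serves for integration in \<open>y\<close>, where
  \<open>exp (y\<^sup>2)\<close> meets the density.\<close>

lemma laguerre_kernel_eq_heat':
  assumes "\<nu> \<ge> 0" "t > 0" "x > 0" "y > 0"
  shows "laguerre_kernel \<nu> t x y = Gamma (\<nu> + 1) * exp (y\<^sup>2) * heat \<nu> (1 - exp (- t)) (exp (- t / 2) * x) y"
proof -
  have "laguerre_kernel \<nu> t x y = laguerre_kernel \<nu> t y x"
    by (simp add: laguerre_kernel_def mult_ac add_ac)
  then show ?thesis
    using laguerre_kernel_eq_heat[OF assms(1,2,4,3)] heat_commute by metis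
qed

lemma exp_complete_square:
  assumes "\<tau> \<noteq> (0::real)"
  shows "exp (2 * (x * y / \<tau>)) * exp (- (x\<^sup>2 + y\<^sup>2) / \<tau>) = exp (- (x - y)\<^sup>2 / \<tau>)"
  unfolding exp_add[symmetric] using assms by (simp add: field_simps power2_eq_square)

text \<open>Apply \<open>bes_le_exp_powr\<close> at \<open>z = 2 * x * y / \<tau>\<close>:
  \<open>exp z\<close> completes the square, and all of the power of \<open>\<tau>\<close> except
  \<open>\<tau> powr (- 1/2)\<close> merges with \<open>z + d\<close> into
  \<open>2 * x * y + d * \<tau>\<close>, where \<open>d = \<nu> + 1/2\<close>.\<close>

lemma heat_le:
  assumes "\<nu> \<ge> 0" "\<tau> > 0" "x \<ge> 0" "y \<ge> 0"
  shows "heat \<nu> \<tau> x y \<le> (\<nu> + 1/2) powr (\<nu> + 1/2) / Gamma (\<nu> + 1) * \<tau> powr (- 1/2) *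
    (2 * x * y + (\<nu> + 1/2) * \<tau>) powr (- (\<nu> + 1/2)) * exp (- (x - y)\<^sup>2 / \<tau>)"
proof -
  define z where "z = 2 * (x * y / \<tau>)"
  define d where "d = \<nu> + 1/2"
  define c where "c = d powr d / Gamma (\<nu> + 1)"
  define b where "b = bes \<nu> ((x * y / \<tau>)\<^sup>2)"
  have z: "z \<ge> 0" "z / 2 = x * y / \<tau>"
    using assms by (auto simp: z_def)
  have pos: "z + d > 0"
    using z(1) assms by (simp only: d_def)
  have one: "(z + d) powr d * (z + d) powr (- d) = 1"
    using pos by (simp add: powr_add[symmetric])
  have "(z + d) powr d * b \<le> c * exp z"
    using bes_le_exp_powr[OF assms(1) z(1)] by (simp only: z(2) b_def c_def d_def add.assoc)
  then have "(z + d) powr d * b * (z + d) powr (- d) \<le> c * exp z * (z + d) powr (- d)"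
    by (intro mult_right_mono) auto
  moreover have "(z + d) powr d * b * (z + d) powr (- d) = b"
    using one by (metis mult.assoc mult.commute mult_1)
  ultimately have "b \<le> c * exp z * (z + d) powr (- d)"
    by simp
  then have "heat \<nu> \<tau> x y \<le> \<tau> powr (- (\<nu> + 1)) * (c * exp z * (z + d) powr (- d)) * exp (- (x\<^sup>2 + y\<^sup>2) / \<tau>)"
    unfolding heat_def b_def by (intro mult_right_mono mult_left_mono) auto
  also have "\<dots> = c * (\<tau> powr (- (\<nu> + 1)) * (z + d) powr (- d)) * (exp z * exp (- (x\<^sup>2 + y\<^sup>2) / \<tau>))"
    by (simp only: mult_ac)
  also have "exp z * exp (- (x\<^sup>2 + y\<^sup>2) / \<tau>) = exp (- (x - y)\<^sup>2 / \<tau>)"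
    unfolding z_def using assms by (intro exp_complete_square) auto
  also have "\<tau> powr (- (\<nu> + 1)) = \<tau> powr (- 1/2) * \<tau> powr (- d)"
    unfolding powr_add[symmetric] by (simp add: d_def add.commute)
  also have "\<tau> powr (- 1/2) * \<tau> powr (- d) * (z + d) powr (- d) = \<tau> powr (- 1/2) * (\<tau> * (z + d)) powr (- d)"
    using assms pos by (simp add: powr_mult)
  also have "\<tau> * (z + d) = 2 * x * y + d * \<tau>"
    using assms by (simp add: z_def field_simps)
  finally show ?thesis by (simp only: c_def d_def mult_ac)
qed

lemma heat_le_const:
  assumes "\<nu> \<ge> 0" "\<tau> > 0" "x \<ge> 0" "y \<ge> 0"
  shows "heat \<nu> \<tau> x y \<le> inverse (Gamma (\<nu> + 1)) * \<tau> powr (- (\<nu> + 1))"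
proof -
  define d where "d = \<nu> + 1/2"
  have d: "d > 0" using assms by (simp add: d_def)
  define G where "G = inverse (Gamma (\<nu> + 1))"
  have G: "G > 0"
    using assms by (auto simp: G_def intro!: Gamma_real_pos)
  have "heat \<nu> \<tau> x y \<le> d powr d * G * \<tau> powr (- 1/2) * (2 * x * y + d * \<tau>) powr (- d) * exp (- (x - y)\<^sup>2 / \<tau>)"
    using heat_le[OF assms] by (simp only: G_def d_def divide_inverse[of _ "Gamma (\<nu> + 1)"])
  also have "\<dots> \<le> d powr d * G * \<tau> powr (- 1/2) * (d * \<tau>) powr (- d) * 1"
  proof (intro mult_mono mult_nonneg_nonneg)
    show "(2 * x * y + d * \<tau>) powr (- d) \<le> (d * \<tau>) powr (- d)"
      using assms d by (intro powr_mono2') auto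
    show "exp (- (x - y)\<^sup>2 / \<tau>) \<le> 1"
      using assms by simp
  qed (use G in auto)
  also have "\<dots> = G * (d powr d * d powr (- d)) * (\<tau> powr (- 1/2) * \<tau> powr (- d))"
    using assms d by (simp add: powr_mult mult_ac)
  also have "d powr d * d powr (- d) = 1"
    using d by (simp add: powr_add[symmetric])
  also have "\<tau> powr (- 1/2) * \<tau> powr (- d) = \<tau> powr (- (\<nu> + 1))"
    unfolding powr_add[symmetric] by (simp add: d_def add.commute)
  finally show ?thesis
    by (simp add: G_def)
qed

text \<open>Raise \<open>u \<le> d / a * exp (a * u / d)\<close> to the power \<open>d\<close>. This
  trades polynomial growth for part of a Gaussian.\<close>

lemma powr_le_exp:
  assumes "d > (0::real)" "a > 0" "u \<ge> 0"
  shows "u powr d \<le> (d / a) powr d * exp (a * u)"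
proof -
  have "u = d / a * (a * u / d)"
    using assms by simp
  also have "\<dots> \<le> d / a * exp (a * u / d)"
    using assms exp_ge_add_one_self[of "a * u / d"] by (intro mult_left_mono) (linarith, simp)
  finally have "u powr d \<le> (d / a * exp (a * u / d)) powr d"
    using assms by (intro powr_mono2) auto
  also have "\<dots> = (d / a) powr d * exp (a * u)"
    unfolding powr_mult exp_powr_real using assms by simp
  finally show ?thesis .
qed

text \<open>The weight is \<open>(x\<^sup>2) powr d\<close>, and \<open>x\<^sup>2\<close> exceeds
  the base \<open>q\<close> from \<open>heat_le\<close> by at most a factor linear in
  \<open>v = (x - y)\<^sup>2 / \<tau>\<close>; half of the Gaussian pays for that factor.\<close>

lemma weighted_heat_le:
  assumes "\<nu> \<ge> 0"
  obtains C where "C \<ge> 0"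
    and "\<And>\<tau> x y. \<tau> > 0 \<Longrightarrow> x > 0 \<Longrightarrow> y \<ge> 0 \<Longrightarrow>
      x powr (2 * \<nu> + 1) * heat \<nu> \<tau> x y \<le> C * \<tau> powr (- 1/2) * exp (- (x - y)\<^sup>2 / (2 * \<tau>))"
proof
  define d where "d = \<nu> + 1/2"
  have d: "d \<ge> 1/2" using assms by (simp add: d_def)
  define c where "c = d powr d / Gamma (\<nu> + 1)"
  \<comment> \<open>\<open>powr_le_exp\<close> will be applied to \<open>1 + 8 * v\<close> with
    \<open>a = 1/16\<close>, so that exactly \<open>exp (v / 2)\<close> is spent.\<close>
  define K where "K = (16 * d) powr d * exp (1 / 16)"
  have c: "c \<ge> 0"
    using assms by (auto simp: c_def intro!: divide_nonneg_pos Gamma_real_pos)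
  show "c * K \<ge> 0"
    using c by (simp add: K_def)
  fix \<tau> x y :: real
  assume *: "\<tau> > 0" "x > 0" "y \<ge> 0"
  define v where "v = (x - y)\<^sup>2 / \<tau>"
  have v: "v \<ge> 0" using * by (simp add: v_def)
  define q where "q = 2 * x * y + d * \<tau>"
  have q: "q > 0"
    unfolding q_def using * d by (intro add_nonneg_pos) auto
  \<comment> \<open>If \<open>x \<le> 2 * y\<close>, the product term of \<open>q\<close> suffices.
    Otherwise \<open>x < 2 * (x - y)\<close>, so \<open>x\<^sup>2\<close> is at most
    \<open>4 * v * \<tau>\<close>, and \<open>d \<ge> 1/2\<close> lets the term
    \<open>d * \<tau>\<close> of \<open>q\<close> take over.\<close>
  have "x\<^sup>2 \<le> (1 + 8 * v) * q"
  proof (cases "x \<le> 2 * y")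
    case True
    have "x\<^sup>2 \<le> 2 * x * y"
      using True * by (simp add: power2_eq_square)
    also have "\<dots> \<le> q"
      using * d by (simp add: q_def)
    also have "\<dots> \<le> (1 + 8 * v) * q"
      using mult_nonneg_nonneg[OF v less_imp_le[OF q]] by (simp only: ring_distribs)
    finally show ?thesis .
  next
    case False
    have "x\<^sup>2 \<le> (2 * (x - y))\<^sup>2"
      using False * by (intro power_mono) auto
    also have "\<dots> = 8 * v * (1 / 2 * \<tau>)"
      unfolding power_mult_distrib using * by (simp add: v_def)
    also have "\<dots> \<le> (1 + 8 * v) * q"
    proof (rule mult_mono)
      have "1 / 2 * \<tau> \<le> d * \<tau>"
        using * d by (intro mult_right_mono) auto
      then show "1 / 2 * \<tau> \<le> q"
        using * unfolding q_def by (intro add_increasing) auto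
    qed (use v * in auto)
    finally show ?thesis .
  qed
  then have "(x\<^sup>2 / q) powr d \<le> (1 + 8 * v) powr d"
    using q d by (intro powr_mono2) (auto simp: divide_simps)
  also have "\<dots> \<le> (d / (1/16)) powr d * exp (1/16 * (1 + 8 * v))"
    using d v by (intro powr_le_exp) auto
  also have "\<dots> = K * exp (v / 2)"
    unfolding K_def mult.assoc exp_add[symmetric] by (simp add: mult.commute)
  finally have 1: "(x\<^sup>2 / q) powr d \<le> K * exp (v / 2)" .
  have 2: "x powr (2 * \<nu> + 1) * q powr (- d) = (x\<^sup>2 / q) powr d"
  proof -
    have e: "x\<^sup>2 = x powr 2"
      using * by simp
    have "(x\<^sup>2 / q) powr d = (x\<^sup>2) powr d * q powr (- d)"
      using q by (simp add: powr_divide powr_minus_divide)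
    also have "(x\<^sup>2) powr d = x powr (2 * \<nu> + 1)"
      unfolding e powr_powr by (simp add: d_def)
    finally show ?thesis by simp
  qed
  have "x powr (2 * \<nu> + 1) * heat \<nu> \<tau> x y \<le> x powr (2 * \<nu> + 1) *
      (c * \<tau> powr (- 1/2) * q powr (- d) * exp (- v))"
    using heat_le[OF assms *(1) less_imp_le[OF *(2)] *(3)]
    by (intro mult_left_mono) (simp_all only: c_def q_def v_def d_def minus_divide_left powr_ge_zero)
  also have "\<dots> = c * \<tau> powr (- 1/2) * exp (- v) * (x powr (2 * \<nu> + 1) * q powr (- d))"
    by (simp only: mult_ac)
  also have "\<dots> \<le> c * \<tau> powr (- 1/2) * exp (- v) * (K * exp (v / 2))"
    unfolding 2 using 1 c by (intro mult_left_mono) auto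
  also have "\<dots> = c * K * \<tau> powr (- 1/2) * (exp (- v) * exp (v / 2))"
    by (simp only: mult_ac)
  also have "exp (- v) * exp (v / 2) = exp (- (x - y)\<^sup>2 / (2 * \<tau>))"
    unfolding exp_add[symmetric] by (simp add: v_def)
  finally show "x powr (2 * \<nu> + 1) * heat \<nu> \<tau> x y \<le> c * K * \<tau> powr (- 1/2) * exp (- (x - y)\<^sup>2 / (2 * \<tau>))" .
qed

section \<open>Derivative bounds and the far-away kernel difference\<close>

text \<open>The \<open>y\<close>-derivative of \<open>heat\<close>, factored so that the last
  bracket is \<open>x * F - y * A\<close>, where for positive arguments \<open>F / A\<close> is the
  quotient I_{\<nu>+1} / I_\<nu> at \<open>2 * x * y / \<tau>\<close>. The ratio bounds quantify the
  cancellation between the two terms.\<close>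

definition heat_dy :: "real \<Rightarrow> real \<Rightarrow> real \<Rightarrow> real \<Rightarrow> real" where
  "heat_dy \<nu> \<tau> x y = \<tau> powr (- (\<nu> + 1)) * exp (- (x\<^sup>2 + y\<^sup>2) / \<tau>) * (2 / \<tau>) *
     (x * (x * y / \<tau> * bes (\<nu> + 1) ((x * y / \<tau>)\<^sup>2)) - y * bes \<nu> ((x * y / \<tau>)\<^sup>2))"

lemma has_real_derivative_heat:
  assumes "\<nu> \<ge> 0" "\<tau> > 0"
  shows "(heat \<nu> \<tau> x has_real_derivative heat_dy \<nu> \<tau> x y) (at y)"
proof -
  have b: "((\<lambda>y. bes \<nu> ((x * y / \<tau>)\<^sup>2)) has_real_derivative
      bes (\<nu> + 1) ((x * y / \<tau>)\<^sup>2) * (2 * (x * y / \<tau>) * (x / \<tau>))) (at y)"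
    by (rule DERIV_chain2[OF has_real_derivative_bes[OF assms(1)]])
       (use assms in \<open>auto intro!: derivative_eq_intros\<close>)
  have e: "((\<lambda>y. exp (- (x\<^sup>2 + y\<^sup>2) / \<tau>)) has_real_derivative exp (- (x\<^sup>2 + y\<^sup>2) / \<tau>) * (- (2 * y) / \<tau>)) (at y)"
    using assms by (auto intro!: derivative_eq_intros)
  have gen: "P * (B * (2 * z * (x / \<tau>))) * E + E * (- (2 * y) / \<tau>) * (P * A) =
      P * E * (2 / \<tau>) * (x * (z * B) - y * A)" for P B z E A :: real
    using assms by (simp add: field_simps)
  show ?thesis
    unfolding heat_def[abs_def] heat_dy_def
    by (rule DERIV_cong[OF DERIV_mult[OF DERIV_cmult[OF b] e]]) (rule gen)
qed

text \<open>Decompose \<open>x * F - y * A = (x - y) * F - y * (A - F)\<close>. The upper ratio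
  bound gives \<open>F \<le> A\<close>, which settles the first term; the lower one makes
  \<open>A - F\<close> at most the fraction \<open>k / (z + k)\<close> of \<open>A\<close>, which
  compensates the factor \<open>y\<close>.\<close>

lemma abs_heat_dy_le:
  assumes "\<nu> \<ge> 0" "\<tau> > 0" "x \<ge> 0" "y \<ge> 0"
  shows "\<bar>heat_dy \<nu> \<tau> x y\<bar> \<le> 2 / \<tau> * (3 * \<bar>x - y\<bar> + sqrt ((2 * \<nu> + 2) * \<tau>)) * heat \<nu> \<tau> x y"
proof -
  define z where "z = 2 * (x * y / \<tau>)"
  define k where "k = 2 * \<nu> + 2"
  define A where "A = bes \<nu> ((x * y / \<tau>)\<^sup>2)"
  define F where "F = x * y / \<tau> * bes (\<nu> + 1) ((x * y / \<tau>)\<^sup>2)"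
  define P where "P = \<tau> powr (- (\<nu> + 1)) * exp (- (x\<^sup>2 + y\<^sup>2) / \<tau>)"
  have z: "z \<ge> 0" "x * y / \<tau> = z / 2"
    using assms by (auto simp: z_def)
  have k: "k > 0" using assms by (simp add: k_def)
  define B where "B = bes (\<nu> + 1) ((z / 2)\<^sup>2)"
  have B: "B > 0"
    using assms by (simp add: B_def bes_pos)
  have A: "A > 0"
    unfolding A_def using assms by (simp add: bes_pos)
  have F: "F = z / 2 * B"
    by (simp only: F_def z(2) B_def)
  have F0: "F \<ge> 0"
    unfolding F using B z(1) by (intro mult_nonneg_nonneg) auto
  have up: "(z + \<nu> + 1/2) / 2 * B \<le> A"
    using bes_ratio_upper[OF assms(1) z(1)] by (simp only: A_def B_def z(2))
  have lo: "A \<le> (z + k) / 2 * B"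
    using bes_ratio_lower[OF assms(1) z(1)] by (simp only: A_def B_def z(2) k_def add.assoc)
  have "z / 2 * B \<le> (z + \<nu> + 1/2) / 2 * B"
    using B assms by (intro mult_right_mono) auto
  with up F have FA: "F \<le> A" by simp
  have "z * A \<le> z * ((z + k) / 2 * B)"
    using lo z by (intro mult_left_mono)
  then have low: "(z + k) * (A - F) \<le> k * A"
    by (simp add: F algebra_simps)
  have yAF: "y * (A - F) \<le> (2 * \<bar>x - y\<bar> + sqrt (k * \<tau>)) * A"
  proof (cases "y \<le> 2 * \<bar>x - y\<bar>")
    case True
    have "y * (A - F) \<le> (2 * \<bar>x - y\<bar>) * A"
      using True F0 FA assms by (intro mult_mono) auto
    also have "\<dots> \<le> (2 * \<bar>x - y\<bar> + sqrt (k * \<tau>)) * A"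
      using A k assms by (intro mult_right_mono) auto
    finally show ?thesis .
  next
    case False
    then have y: "y > 0" "y \<le> 2 * x"
      using assms by (auto simp: abs_if split: if_splits)
    \<comment> \<open>In this case \<open>y\<^sup>2 \<le> 2 * x * y = \<tau> * z\<close>. The choice
      \<open>s\<^sup>2 = k * \<tau>\<close> then yields \<open>s * y \<le> \<tau> * (z + k)\<close>
      by the arithmetic-geometric mean inequality.\<close>
    define s where "s = sqrt (k * \<tau>)"
    have s: "s > 0" "s\<^sup>2 = k * \<tau>"
      using k assms by (auto simp: s_def)
    have "y * y \<le> 2 * x * y"
      using y by (intro mult_right_mono) auto
    moreover have "2 * (s * y) \<le> s\<^sup>2 + y\<^sup>2"
      using sum_squares_bound[of s y] by simp
    moreover have "s * y > 0" using s y by simp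
    ultimately have "s * y \<le> \<tau> * (z + k)"
      using s assms by (simp add: z_def power2_eq_square algebra_simps)
    then have "s * y * (A - F) \<le> \<tau> * (z + k) * (A - F)"
      using FA by (intro mult_right_mono) auto
    also have "\<dots> \<le> \<tau> * (k * A)"
      unfolding mult.assoc using low assms by (intro mult_left_mono) auto
    also have "\<dots> = s * (s * A)"
      using s(2) by (simp add: power2_eq_square mult_ac)
    finally have "y * (A - F) \<le> s * A"
      using s by (simp add: mult.assoc)
    also have "\<dots> \<le> (2 * \<bar>x - y\<bar> + s) * A"
      using A by (intro mult_right_mono) auto
    finally show ?thesis by (simp only: s_def)
  qed
  have "\<bar>x * F - y * A\<bar> = \<bar>(x - y) * F - y * (A - F)\<bar>"
    by (simp add: algebra_simps)
  also have "\<dots> \<le> \<bar>x - y\<bar> * F + y * (A - F)"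
    using F0 FA assms abs_triangle_ineq4[of "(x - y) * F" "y * (A - F)"] by (simp add: abs_mult)
  also have "\<dots> \<le> \<bar>x - y\<bar> * A + (2 * \<bar>x - y\<bar> + sqrt (k * \<tau>)) * A"
    using FA yAF by (intro add_mono mult_left_mono) auto
  also have "\<dots> = (3 * \<bar>x - y\<bar> + sqrt (k * \<tau>)) * A"
    by (simp add: algebra_simps)
  finally have "P * (2 / \<tau>) * \<bar>x * F - y * A\<bar> \<le> P * (2 / \<tau>) * ((3 * \<bar>x - y\<bar> + sqrt (k * \<tau>)) * A)"
    using assms by (intro mult_left_mono) (auto simp: P_def)
  moreover have "\<bar>heat_dy \<nu> \<tau> x y\<bar> = P * (2 / \<tau>) * \<bar>x * F - y * A\<bar>"
    using assms by (simp add: heat_dy_def abs_mult P_def A_def F_def)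
  moreover have "heat \<nu> \<tau> x y = P * A"
    by (simp add: heat_def P_def A_def)
  ultimately show ?thesis
    by (simp add: k_def mult_ac)
qed

text \<open>Here \<open>v\<close> stands for \<open>\<bar>x - y\<bar> / sqrt \<tau>\<close>. Both
  polynomial factors are dominated by multiples of
  \<open>1 + v\<^sup>2 \<le> 4 * exp (v\<^sup>2 / 4)\<close>, whence the constant
  \<open>8 * 16\<close>.\<close>

lemma cubic_exp_bound:
  fixes v k :: real
  assumes "v \<ge> 0" "k \<ge> 0"
  shows "(8 * v\<^sup>2 + 4) * (3 * v + k) * exp (- v\<^sup>2 / 2) \<le> 128 * (3 + k)"
proof -
  have "v \<le> 1 + v\<^sup>2"
    using sum_squares_bound[of v 1] assms by simp
  then have "3 * v + k \<le> (3 + k) * (1 + v\<^sup>2)"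
    using mult_nonneg_nonneg[OF assms(2) zero_le_power2[of v]] by (simp add: algebra_simps)
  then have "(8 * v\<^sup>2 + 4) * (3 * v + k) \<le> (8 * (1 + v\<^sup>2)) * ((3 + k) * (1 + v\<^sup>2))"
    using assms by (intro mult_mono) auto
  also have "\<dots> = 8 * (3 + k) * (1 + v\<^sup>2)\<^sup>2"
    by (simp only: power2_eq_square mult_ac)
  also have "\<dots> \<le> 8 * (3 + k) * (4 * exp (v\<^sup>2 / 4))\<^sup>2"
  proof (intro mult_left_mono power_mono)
    show "1 + v\<^sup>2 \<le> 4 * exp (v\<^sup>2 / 4)"
      using exp_ge_add_one_self[of "v\<^sup>2 / 4"] by (simp only: field_simps)
  qed (use assms in auto)
  also have "\<dots> = 128 * (3 + k) * exp (v\<^sup>2 / 2)"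
    by (simp add: power_mult_distrib exp_double[symmetric])
  finally have "(8 * v\<^sup>2 + 4) * (3 * v + k) * exp (- v\<^sup>2 / 2) \<le> 128 * (3 + k) * exp (v\<^sup>2 / 2) * exp (- v\<^sup>2 / 2)"
    by (intro mult_right_mono) auto
  also have "\<dots> = 128 * (3 + k)"
    unfolding mult.assoc exp_add[symmetric] by simp
  finally show ?thesis .
qed

text \<open>The bound is uniform in \<open>\<tau>\<close>, so it survives a supremum over times:
  \<open>D\<^sup>2\<close> contributes a factor \<open>\<tau>\<close> cancelling the
  \<open>1 / \<tau>\<close> of the derivative bound, and the Gaussian absorbs the remaining
  polynomial. \<open>D\<close> may exceed \<open>\<bar>x - y\<bar>\<close> because it will be a
  distance before dilation, which \<open>parabolic_shift\<close> controls in this form.\<close>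

lemma weighted_heat_dy_le:
  assumes "\<nu> \<ge> 0"
  obtains C where "C \<ge> 0"
    and "\<And>\<tau> x y D. \<tau> > 0 \<Longrightarrow> x > 0 \<Longrightarrow> y \<ge> 0 \<Longrightarrow> 0 \<le> D \<Longrightarrow> D \<le> 2 * \<bar>x - y\<bar> + sqrt (2 * \<tau>) \<Longrightarrow>
      D\<^sup>2 * x powr (2 * \<nu> + 1) * \<bar>heat_dy \<nu> \<tau> x y\<bar> \<le> C"
proof -
  obtain C where C: "C \<ge> 0" and heat: "\<And>\<tau> x y. \<tau> > 0 \<Longrightarrow> x > 0 \<Longrightarrow> y \<ge> 0 \<Longrightarrow>
      x powr (2 * \<nu> + 1) * heat \<nu> \<tau> x y \<le> C * \<tau> powr (- 1/2) * exp (- (x - y)\<^sup>2 / (2 * \<tau>))"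
    using weighted_heat_le[OF assms] by metis
  define k where "k = sqrt (2 * \<nu> + 2)"
  have k: "k \<ge> 0" using assms by (simp add: k_def)
  show ?thesis
  proof (rule that)
    show "2 * C * (128 * (3 + k)) \<ge> 0"
      using C k by simp
    fix \<tau> x y D :: real
    assume *: "\<tau> > 0" "x > 0" "y \<ge> 0" "0 \<le> D" "D \<le> 2 * \<bar>x - y\<bar> + sqrt (2 * \<tau>)"
    define s where "s = sqrt \<tau>"
    define v where "v = \<bar>x - y\<bar> / s"
    have s: "s > 0" "s\<^sup>2 = \<tau>" "\<tau> powr (- 1/2) = 1 / s"
      using * by (auto simp: s_def powr_minus_divide powr_half_sqrt)
    have v: "v \<ge> 0" "\<bar>x - y\<bar> = v * s"
      using s by (auto simp: v_def)
    have v2: "(x - y)\<^sup>2 = v\<^sup>2 * \<tau>"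
      using v(2) s(2) by (metis power2_abs power_mult_distrib)
    have sq2: "sqrt (2 * \<tau>) = sqrt 2 * s" and sqk: "sqrt ((2 * \<nu> + 2) * \<tau>) = k * s"
      by (auto simp: s_def k_def real_sqrt_mult)
    have "D\<^sup>2 \<le> ((2 * v + sqrt 2) * s)\<^sup>2"
      using * v sq2 by (intro power_mono) (auto simp: algebra_simps)
    also have "\<dots> = (2 * v + sqrt 2)\<^sup>2 * \<tau>"
      by (simp add: power_mult_distrib s)
    also have "\<dots> \<le> (8 * v\<^sup>2 + 4) * \<tau>"
    proof (intro mult_right_mono)
      show "(2 * v + sqrt 2)\<^sup>2 \<le> 8 * v\<^sup>2 + 4"
        using sum_squares_bound[of "2 * v" "sqrt 2"] by (simp add: power2_sum power_mult_distrib)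
    qed (use * in auto)
    finally have D: "D\<^sup>2 \<le> (8 * v\<^sup>2 + 4) * \<tau>" .
    have "x powr (2 * \<nu> + 1) * \<bar>heat_dy \<nu> \<tau> x y\<bar> \<le>
        x powr (2 * \<nu> + 1) * (2 / \<tau> * (3 * \<bar>x - y\<bar> + sqrt ((2 * \<nu> + 2) * \<tau>)) * heat \<nu> \<tau> x y)"
      using assms * by (intro mult_left_mono abs_heat_dy_le) auto
    also have "\<dots> = 2 / \<tau> * (3 * \<bar>x - y\<bar> + sqrt ((2 * \<nu> + 2) * \<tau>)) * (x powr (2 * \<nu> + 1) * heat \<nu> \<tau> x y)"
      by (simp only: mult_ac)
    also have "\<dots> \<le> 2 / \<tau> * (3 * \<bar>x - y\<bar> + sqrt ((2 * \<nu> + 2) * \<tau>)) *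
        (C * \<tau> powr (- 1/2) * exp (- (x - y)\<^sup>2 / (2 * \<tau>)))"
      using * assms by (intro mult_left_mono heat) auto
    also have "\<dots> = 2 * C / \<tau> * ((3 * v + k) * exp (- v\<^sup>2 / 2))"
      unfolding v sqk v2 s(3) using s *(1) by (simp add: field_simps)
    finally have "x powr (2 * \<nu> + 1) * \<bar>heat_dy \<nu> \<tau> x y\<bar> \<le> 2 * C / \<tau> * ((3 * v + k) * exp (- v\<^sup>2 / 2))" .
    then have "D\<^sup>2 * (x powr (2 * \<nu> + 1) * \<bar>heat_dy \<nu> \<tau> x y\<bar>) \<le>
        (8 * v\<^sup>2 + 4) * \<tau> * (2 * C / \<tau> * ((3 * v + k) * exp (- v\<^sup>2 / 2)))"
      by (rule mult_mono[OF D]) (use * in auto)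
    also have "\<dots> = 2 * C * ((8 * v\<^sup>2 + 4) * (3 * v + k) * exp (- v\<^sup>2 / 2))"
      using *(1) by (simp add: divide_simps)
    also have "\<dots> \<le> 2 * C * (128 * (3 + k))"
      using C k v cubic_exp_bound[of v k] by (intro mult_left_mono) auto
    finally show "D\<^sup>2 * x powr (2 * \<nu> + 1) * \<bar>heat_dy \<nu> \<tau> x y\<bar> \<le> 2 * C * (128 * (3 + k))"
      by (simp only: mult.assoc)
  qed
qed

text \<open>The truncation enters here: \<open>t < (m_fun x)\<^sup>2\<close> gives
  \<open>t < 1\<close> and \<open>t * x \<le> sqrt t\<close>. The dilation then moves
  \<open>y\<close> by at most \<open>\<bar>x - y\<bar> / 2 + sqrt t / 2\<close>, and the first
  summand is absorbed on the left.\<close>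

lemma parabolic_shift:
  fixes t x y :: real
  assumes "0 < t" "t < (m_fun x)\<^sup>2" "x > 0" "y \<ge> 0"
  shows "\<bar>x - y\<bar> \<le> 2 * \<bar>x - exp (- t / 2) * y\<bar> + sqrt (2 * (1 - exp (- t)))"
proof -
  define \<rho> where "\<rho> = exp (- t / 2)"
  have m: "0 < m_fun x" "m_fun x \<le> 1" "m_fun x * x \<le> 1"
    using assms by (auto simp: m_fun_def min_def field_simps)
  have "(m_fun x)\<^sup>2 \<le> 1"
    using m by (simp add: power_le_one)
  with assms have t1: "t < 1" by simp
  have st: "sqrt t \<le> m_fun x"
    using assms m by (intro real_le_lsqrt) auto
  have "t * x = sqrt t * (sqrt t * x)"
    using assms by simp
  also have "\<dots> \<le> sqrt t * 1"
  proof (rule mult_left_mono)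
    show "sqrt t * x \<le> 1"
      using mult_right_mono[OF st, of x] m assms by linarith
  qed (use assms in simp)
  finally have tx: "t * x \<le> sqrt t" by simp
  have \<rho>: "1 - \<rho> \<le> t / 2" "\<rho> \<le> 1"
    using exp_ge_add_one_self[of "- t / 2"] assms by (auto simp: \<rho>_def)
  \<comment> \<open>The inequality \<open>y \<le> \<bar>x - y\<bar> + x\<close> trades
    \<open>y\<close> for \<open>x\<close>, about which the truncation says something.\<close>
  have "(1 - \<rho>) * y \<le> t / 2 * (\<bar>x - y\<bar> + x)"
    using \<rho> assms by (intro mult_mono) auto
  also have "\<dots> \<le> 1 / 2 * \<bar>x - y\<bar> + t * x / 2"
    using t1 mult_right_mono[of t 1 "\<bar>x - y\<bar>"] by (simp add: algebra_simps)
  finally have "(1 - \<rho>) * y \<le> \<bar>x - y\<bar> / 2 + sqrt t / 2"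
    using tx by simp
  moreover have "\<bar>x - y\<bar> \<le> \<bar>x - \<rho> * y\<bar> + (1 - \<rho>) * y"
  proof -
    have "x - y = (x - \<rho> * y) - (1 - \<rho>) * y"
      by (simp add: algebra_simps)
    moreover have "(1 - \<rho>) * y \<ge> 0"
      using \<rho> assms by simp
    ultimately show ?thesis
      by linarith
  qed
  moreover have "a \<le> 2 * b + s" if "w \<le> a / 2 + s / 2" "a \<le> b + w" for a b s w :: real
    using that by linarith
  ultimately have "\<bar>x - y\<bar> \<le> 2 * \<bar>x - \<rho> * y\<bar> + sqrt t"
    by blast
  \<comment> \<open>This amounts to \<open>t / 2 \<le> 1 - exp (- t)\<close> for
    \<open>0 < t < 1\<close> and passes from \<open>t\<close> to the heat time.\<close>
  moreover have "sqrt t \<le> sqrt (2 * (1 - exp (- t)))"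
  proof -
    have "exp (- t) \<le> 1 / (1 + t)"
      using assms exp_ge_add_one_self[of t] by (simp add: exp_minus field_simps)
    also have "\<dots> \<le> 1 - t / 2"
    proof -
      have "t * t \<le> t" using t1 assms by (simp add: mult_left_le)
      then show ?thesis using assms by (simp add: field_simps)
    qed
    finally show ?thesis by simp
  qed
  ultimately show ?thesis
    unfolding \<rho>_def by (meson add_left_mono order_trans)
qed

text \<open>Mean value inequality along the segment from \<open>\<rho> * x0\<close> to
  \<open>\<rho> * y\<close>. Its points are \<open>\<rho> * e\<close> with \<open>e\<close> between
  \<open>x0\<close> and \<open>y\<close>, and \<open>parabolic_shift\<close> makes a lower bound for
  \<open>\<bar>x - e\<bar>\<close> a legitimate \<open>D\<close> in
  \<open>weighted_heat_dy_le\<close>. The factor \<open>exp (- x\<^sup>2)\<close> cancels the one in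
  \<open>laguerre_kernel_eq_heat\<close>.\<close>

lemma kernel_difference_bound:
  assumes "\<nu> \<ge> 0"
  obtains C where "C \<ge> 0"
    and "\<And>t x y x0 r. 0 < t \<Longrightarrow> t < (m_fun x)\<^sup>2 \<Longrightarrow> x > 0 \<Longrightarrow> y > 0 \<Longrightarrow> x0 > 0 \<Longrightarrow> r > 0 \<Longrightarrow>
      \<bar>y - x0\<bar> \<le> r \<Longrightarrow> \<bar>x - x0\<bar> \<ge> 2 * r \<Longrightarrow>
      x powr (2 * \<nu> + 1) * exp (- x\<^sup>2) * \<bar>laguerre_kernel \<nu> t x y - laguerre_kernel \<nu> t x x0\<bar>
        \<le> C * (r / (x - x0)\<^sup>2)"
proof -
  obtain C where C: "C \<ge> 0" and dy: "\<And>\<tau> x y D. \<tau> > 0 \<Longrightarrow> x > 0 \<Longrightarrow> y \<ge> 0 \<Longrightarrow> 0 \<le> D \<Longrightarrow>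
      D \<le> 2 * \<bar>x - y\<bar> + sqrt (2 * \<tau>) \<Longrightarrow> D\<^sup>2 * x powr (2 * \<nu> + 1) * \<bar>heat_dy \<nu> \<tau> x y\<bar> \<le> C"
    using weighted_heat_dy_le[OF assms] by metis
  have G: "Gamma (\<nu> + 1) > 0"
    using assms by (intro Gamma_real_pos) auto
  show ?thesis
  proof (rule that)
    show "4 * Gamma (\<nu> + 1) * C \<ge> 0"
      using G C by simp
    fix t x y x0 r :: real
    assume *: "0 < t" "t < (m_fun x)\<^sup>2" "x > 0" "y > 0" "x0 > 0" "r > 0"
      "\<bar>y - x0\<bar> \<le> r" "\<bar>x - x0\<bar> \<ge> 2 * r"
    define \<rho> where "\<rho> = exp (- t / 2)"
    define \<tau> where "\<tau> = 1 - exp (- t)"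
    define p where "p = x powr (2 * \<nu> + 1)"
    \<comment> \<open>Half the distance survives for every \<open>e\<close> within \<open>r\<close>
      of \<open>x0\<close>, as \<open>2 * r \<le> \<bar>x - x0\<bar>\<close>; its square gives the 4
      in the final constant.\<close>
    define D where "D = \<bar>x - x0\<bar> / 2"
    have \<rho>: "\<rho> > 0" "\<rho> \<le> 1" and \<tau>: "\<tau> > 0" and p: "p > 0" and D: "D > 0"
      using * by (auto simp: \<rho>_def \<tau>_def p_def D_def)
    have "\<bar>heat \<nu> \<tau> x (\<rho> * y) - heat \<nu> \<tau> x (\<rho> * x0)\<bar> \<le> C / (D\<^sup>2 * p) * \<bar>\<rho> * y - \<rho> * x0\<bar>"
      unfolding real_norm_def[symmetric]
    proof (rule field_differentiable_bound[of "closed_segment (\<rho> * x0) (\<rho> * y)" _ "heat_dy \<nu> \<tau> x"])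
      fix u assume "u \<in> closed_segment (\<rho> * x0) (\<rho> * y)"
      then obtain \<theta> where \<theta>: "0 \<le> \<theta>" "\<theta> \<le> 1" "u = (1 - \<theta>) * (\<rho> * x0) + \<theta> * (\<rho> * y)"
        by (auto simp: closed_segment_def)
      define e where "e = x0 + \<theta> * (y - x0)"
      have u: "u = \<rho> * e"
        by (simp add: \<theta> e_def algebra_simps)
      have "e = (1 - \<theta>) * x0 + \<theta> * y"
        by (simp add: e_def algebra_simps)
      then have e0: "e \<ge> 0"
        using \<theta> * by simp
      have "\<bar>e - x0\<bar> \<le> 1 * r"
        unfolding e_def using \<theta> * by (simp add: abs_mult) (intro mult_le_one mult_mono order_trans[OF mult_left_le_one_le], auto)
      then have "D \<le> \<bar>x - e\<bar>"
        unfolding D_def using *(8) abs_triangle_ineq[of "x - e" "e - x0"] by simp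
      also have "\<dots> \<le> 2 * \<bar>x - u\<bar> + sqrt (2 * \<tau>)"
        unfolding u \<rho>_def \<tau>_def using * e0 by (intro parabolic_shift) auto
      finally have "D\<^sup>2 * p * \<bar>heat_dy \<nu> \<tau> x u\<bar> \<le> C"
        unfolding p_def using D \<tau> *(3) \<rho> e0 by (intro dy) (auto simp: u)
      then show "norm (heat_dy \<nu> \<tau> x u) \<le> C / (D\<^sup>2 * p)"
        using D p by (simp add: field_simps)
      show "(heat \<nu> \<tau> x has_field_derivative heat_dy \<nu> \<tau> x u) (at u within closed_segment (\<rho> * x0) (\<rho> * y))"
        by (rule has_field_derivative_at_within[OF has_real_derivative_heat[OF assms \<tau>]])
    qed auto
    also have "\<bar>\<rho> * y - \<rho> * x0\<bar> = \<rho> * \<bar>y - x0\<bar>"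
      using \<rho> by (simp add: abs_mult flip: right_diff_distrib)
    also have "C / (D\<^sup>2 * p) * (\<rho> * \<bar>y - x0\<bar>) \<le> C / (D\<^sup>2 * p) * (1 * r)"
      using * \<rho> C p by (intro mult_left_mono mult_mono) auto
    finally have diff: "p * \<bar>heat \<nu> \<tau> x (\<rho> * y) - heat \<nu> \<tau> x (\<rho> * x0)\<bar> \<le> 4 * C * (r / (x - x0)\<^sup>2)"
      using p D by (simp add: D_def field_simps power_divide)
    have "p * exp (- x\<^sup>2) * \<bar>laguerre_kernel \<nu> t x y - laguerre_kernel \<nu> t x x0\<bar> =
        Gamma (\<nu> + 1) * (exp (- x\<^sup>2) * exp (x\<^sup>2)) * (p * \<bar>heat \<nu> \<tau> x (\<rho> * y) - heat \<nu> \<tau> x (\<rho> * x0)\<bar>)"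
    proof -
      have "laguerre_kernel \<nu> t x u = Gamma (\<nu> + 1) * exp (x\<^sup>2) * heat \<nu> \<tau> x (\<rho> * u)" if "u > 0" for u
        unfolding \<rho>_def \<tau>_def using assms * that by (intro laguerre_kernel_eq_heat)
      then show ?thesis
        using * G by (simp add: abs_mult flip: right_diff_distrib)
    qed
    also have "exp (- x\<^sup>2) * exp (x\<^sup>2) = 1"
      unfolding exp_add[symmetric] by simp
    also have "Gamma (\<nu> + 1) * 1 * (p * \<bar>heat \<nu> \<tau> x (\<rho> * y) - heat \<nu> \<tau> x (\<rho> * x0)\<bar>) \<le>
        Gamma (\<nu> + 1) * 1 * (4 * C * (r / (x - x0)\<^sup>2))"
      using diff G by (intro mult_left_mono) auto
    finally show "x powr (2 * \<nu> + 1) * exp (- x\<^sup>2) * \<bar>laguerre_kernel \<nu> t x y - laguerre_kernel \<nu> t x x0\<bar>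
        \<le> 4 * Gamma (\<nu> + 1) * C * (r / (x - x0)\<^sup>2)"
      by (simp only: p_def mult_ac mult_1)
  qed
qed

section \<open>The Gaussian-type measure\<close>

definition gamma_density :: "real \<Rightarrow> real \<Rightarrow> real" where
  "gamma_density \<nu> x = 2 * x powr (2 * \<nu> + 1) / Gamma (\<nu> + 1) * exp (- x\<^sup>2)"

lemma gamma_density_nonneg: "\<nu> \<ge> 0 \<Longrightarrow> gamma_density \<nu> x \<ge> 0"
  unfolding gamma_density_def by (intro mult_nonneg_nonneg divide_nonneg_pos Gamma_real_pos) auto

lemma borel_measurable_gamma_density [measurable]: "gamma_density \<nu> \<in> borel_measurable borel"
  unfolding gamma_density_def[abs_def] by measurable

lemma space_gamma_measure [simp]: "space (gamma_measure \<nu>) = {0<..}"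
  by (simp add: gamma_measure_def space_restrict_space)

lemma sets_gamma_measure: "sets (gamma_measure \<nu>) = sets (restrict_space borel {0<..})"
  by (simp add: gamma_measure_def sets_restrict_space)

lemma sets_gamma_measure_iff: "A \<in> sets (gamma_measure \<nu>) \<longleftrightarrow> A \<subseteq> {0<..} \<and> A \<in> sets borel"
  unfolding sets_gamma_measure by (subst sets_restrict_space_iff) auto

lemma measurable_gamma_measure_eq:
  "borel_measurable (gamma_measure \<nu>) = borel_measurable (restrict_space borel {0<..})"
  by (rule measurable_cong_sets) (auto simp: sets_gamma_measure)

lemma borel_measurable_gammaI: "f \<in> borel_measurable borel \<Longrightarrow> f \<in> borel_measurable (gamma_measure \<nu>)"
  unfolding measurable_gamma_measure_eq by (rule measurable_restrict_space1)

lemma nn_integral_gamma_measure: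
  assumes "f \<in> borel_measurable (gamma_measure \<nu>)"
  shows "(\<integral>\<^sup>+x. f x \<partial>gamma_measure \<nu>) = (\<integral>\<^sup>+x. ennreal (gamma_density \<nu> x) * f x * indicator {0<..} x \<partial>lborel)"
proof -
  have f: "f \<in> borel_measurable (restrict_space lborel {0<..})"
    using assms unfolding gamma_measure_def by simp
  have d: "(\<lambda>x. ennreal (gamma_density \<nu> x)) \<in> borel_measurable (restrict_space lborel {0<..})"
    by (rule measurable_restrict_space1) measurable
  have "(\<integral>\<^sup>+x. f x \<partial>gamma_measure \<nu>) =
      (\<integral>\<^sup>+x. ennreal (gamma_density \<nu> x) * f x \<partial>restrict_space lborel {0<..})"
    unfolding gamma_measure_def gamma_density_def[symmetric] by (rule nn_integral_density[OF d f])
  also have "\<dots> = (\<integral>\<^sup>+x. ennreal (gamma_density \<nu> x) * f x * indicator {0<..} x \<partial>lborel)"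
    by (rule nn_integral_restrict_space) auto
  finally show ?thesis .
qed

section \<open>Scale-free model integrals on the line, and finiteness of the total mass\<close>

lemma nn_integral_gaussian:
  assumes "\<tau> > 0"
  shows "(\<integral>\<^sup>+y. ennreal (\<tau> powr (- 1/2) * exp (- (c - y)\<^sup>2 / (2 * \<tau>))) \<partial>lborel) = ennreal (sqrt (2 * pi))"
proof -
  interpret prob_space "density lborel (normal_density c (sqrt \<tau>))"
    by (rule prob_space_normal_density) (use assms in simp)
  have 1: "(\<integral>\<^sup>+y. ennreal (normal_density c (sqrt \<tau>) y) \<partial>lborel) = 1"
    using emeasure_space_1 by (simp add: emeasure_density)
  have "\<tau> powr (- 1/2) * exp (- (c - y)\<^sup>2 / (2 * \<tau>)) = sqrt (2 * pi) * normal_density c (sqrt \<tau>) y" for y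
    using assms by (simp add: normal_density_def powr_minus_divide powr_half_sqrt real_sqrt_mult power2_commute)
  then have "(\<integral>\<^sup>+y. ennreal (\<tau> powr (- 1/2) * exp (- (c - y)\<^sup>2 / (2 * \<tau>))) \<partial>lborel) =
      (\<integral>\<^sup>+y. ennreal (sqrt (2 * pi)) * ennreal (normal_density c (sqrt \<tau>) y) \<partial>lborel)"
    by (simp add: ennreal_mult)
  also have "\<dots> = ennreal (sqrt (2 * pi))"
    using 1 by (simp add: nn_integral_cmult)
  finally show ?thesis .
qed

lemma nn_integral_inverse_square_atLeast:
  "(\<integral>\<^sup>+x. ennreal (1 / x\<^sup>2) * indicator {2..} x \<partial>lborel) = ennreal (1 / 2)"
proof -
  have "(\<integral>\<^sup>+x. ennreal (1 / x\<^sup>2) * indicator {2..} x \<partial>lborel) = ennreal (0 - (- (1 / 2)))"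
  proof (rule nn_integral_FTC_atLeast)
    show "((\<lambda>x::real. - (1 / x)) \<longlongrightarrow> 0) at_top"
      using tendsto_minus[OF tendsto_inverse_0_at_top[OF filterlim_ident]] by (simp add: inverse_eq_divide)
    show "((\<lambda>x::real. - (1 / x)) has_real_derivative 1 / x\<^sup>2) (at x)" if "2 \<le> x" for x
      using that by (auto intro!: derivative_eq_intros simp: power2_eq_square)
  qed auto
  then show ?thesis by simp
qed

text \<open>The substitution \<open>x0 + r * x\<close> removes both parameters and leaves twice the
  tail integral of \<open>1 / x\<^sup>2\<close> from 2.\<close>

lemma nn_integral_inverse_square_far:
  fixes r x0 :: real
  assumes "r > 0"
  shows "(\<integral>\<^sup>+x. ennreal (r / (x - x0)\<^sup>2) * indicator {x. \<bar>x - x0\<bar> \<ge> 2 * r} x \<partial>lborel) \<le> 1"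
proof -
  let ?g = "\<lambda>x::real. ennreal (1 / x\<^sup>2) * indicator {2..} x"
  have m: "{x. \<bar>x - x0\<bar> \<ge> 2 * r} \<in> sets borel"
    by measurable
  have "(\<integral>\<^sup>+x. ennreal (r / (x - x0)\<^sup>2) * indicator {x. \<bar>x - x0\<bar> \<ge> 2 * r} x \<partial>lborel) =
      \<bar>r\<bar> * (\<integral>\<^sup>+x. ennreal (r / ((x0 + r * x) - x0)\<^sup>2) * indicator {x. \<bar>x - x0\<bar> \<ge> 2 * r} (x0 + r * x) \<partial>lborel)"
    using assms m by (intro nn_integral_real_affine) auto
  also have "\<dots> = (\<integral>\<^sup>+x. \<bar>r\<bar> * (ennreal (r / ((x0 + r * x) - x0)\<^sup>2) * indicator {x. \<bar>x - x0\<bar> \<ge> 2 * r} (x0 + r * x)) \<partial>lborel)"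
    using m by (intro nn_integral_cmult[symmetric]) measurable
  \<comment> \<open>The reflected copy of \<open>?g\<close> covers the negative half-line.\<close>
  also have "\<dots> \<le> (\<integral>\<^sup>+x. ?g x + ?g (0 + (- 1) * x) \<partial>lborel)"
  proof (rule nn_integral_mono)
    fix x :: real
    have 1: "ennreal \<bar>r\<bar> * ennreal (r / ((x0 + r * x) - x0)\<^sup>2) = ennreal (1 / x\<^sup>2)"
    proof -
      have "\<bar>r\<bar> * (r / ((x0 + r * x) - x0)\<^sup>2) = 1 / x\<^sup>2"
        using assms by (simp add: power2_eq_square)
      moreover have "r / ((x0 + r * x) - x0)\<^sup>2 \<ge> 0"
        using assms by simp
      ultimately show ?thesis
        by (metis abs_ge_zero ennreal_mult)
    qed
    have 2: "indicator {x. \<bar>x - x0\<bar> \<ge> 2 * r} (x0 + r * x) = (indicator {2..} \<bar>x\<bar> :: ennreal)"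
      using assms by (auto simp: indicator_def abs_mult)
    have "ennreal \<bar>r\<bar> * (ennreal (r / ((x0 + r * x) - x0)\<^sup>2) * indicator {x. \<bar>x - x0\<bar> \<ge> 2 * r} (x0 + r * x))
        = ennreal (1 / x\<^sup>2) * indicator {2..} \<bar>x\<bar>"
      unfolding 2 mult.assoc[symmetric] 1 ..
    also have "\<dots> \<le> ?g x + ?g (0 + (- 1) * x)"
      by (cases "x \<ge> 0") (auto simp: indicator_def)
    finally show "ennreal \<bar>r\<bar> * (ennreal (r / ((x0 + r * x) - x0)\<^sup>2) * indicator {x. \<bar>x - x0\<bar> \<ge> 2 * r} (x0 + r * x))
        \<le> ?g x + ?g (0 + (- 1) * x)" .
  qed
  also have "\<dots> = (\<integral>\<^sup>+x. ?g x \<partial>lborel) + (\<integral>\<^sup>+x. ?g (0 + (- 1) * x) \<partial>lborel)"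
    by (rule nn_integral_add) measurable
  also have "(\<integral>\<^sup>+x. ?g (0 + (- 1) * x) \<partial>lborel) = (\<integral>\<^sup>+x. ?g x \<partial>lborel)"
    using nn_integral_real_affine[of ?g "- 1" 0] by simp
  also have "(\<integral>\<^sup>+x. ?g x \<partial>lborel) + (\<integral>\<^sup>+x. ?g x \<partial>lborel) = 1"
    unfolding nn_integral_inverse_square_atLeast by (subst ennreal_plus[symmetric]) auto
  finally show ?thesis .
qed

lemma finite_measure_gamma:
  assumes "\<nu> \<ge> 0"
  shows "finite_measure (gamma_measure \<nu>)"
proof (rule finite_measureI)
  \<comment> \<open>Half of the Gaussian absorbs the power through \<open>powr_le_exp\<close> with
    \<open>a = 1/2\<close>; the other half is the model Gaussian with
    \<open>\<tau> = 1\<close>.\<close>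
  let ?c = "2 / Gamma (\<nu> + 1) * ((2 * \<nu> + 1) powr (\<nu> + 1/2))"
  have c: "?c \<ge> 0"
    using assms by (intro mult_nonneg_nonneg divide_nonneg_pos Gamma_real_pos) auto
  have "emeasure (gamma_measure \<nu>) (space (gamma_measure \<nu>)) = (\<integral>\<^sup>+x. 1 \<partial>gamma_measure \<nu>)"
    by simp
  also have "\<dots> = (\<integral>\<^sup>+x. ennreal (gamma_density \<nu> x) * 1 * indicator {0<..} x \<partial>lborel)"
    by (rule nn_integral_gamma_measure) simp
  also have "\<dots> \<le> (\<integral>\<^sup>+x. ennreal ?c * ennreal (1 powr (- 1/2) * exp (- (0 - x)\<^sup>2 / (2 * 1))) \<partial>lborel)"
  proof (rule nn_integral_mono)
    fix x :: real
    show "ennreal (gamma_density \<nu> x) * 1 * indicator {0<..} x \<le> ennreal ?c * ennreal (1 powr (- 1/2) * exp (- (0 - x)\<^sup>2 / (2 * 1)))"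
    proof (cases "x > 0")
      case True
      have e: "x\<^sup>2 = x powr 2"
        using True by simp
      have "x powr (2 * \<nu> + 1) = (x\<^sup>2) powr (\<nu> + 1/2)"
        unfolding e powr_powr by (simp add: algebra_simps)
      also have "\<dots> \<le> ((\<nu> + 1/2) / (1/2)) powr (\<nu> + 1/2) * exp (1/2 * x\<^sup>2)"
        using assms by (intro powr_le_exp) auto
      also have "(\<nu> + 1/2) / (1/2) = 2 * \<nu> + 1"
        by simp
      finally have "2 / Gamma (\<nu> + 1) * x powr (2 * \<nu> + 1) * exp (- x\<^sup>2) \<le>
          2 / Gamma (\<nu> + 1) * ((2 * \<nu> + 1) powr (\<nu> + 1/2) * exp (1/2 * x\<^sup>2)) * exp (- x\<^sup>2)"
        using assms by (intro mult_right_mono mult_left_mono) (auto intro!: divide_nonneg_pos Gamma_real_pos)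
      also have "\<dots> = ?c * (exp (1/2 * x\<^sup>2) * exp (- x\<^sup>2))"
        by (simp only: mult_ac)
      also have "exp (1/2 * x\<^sup>2) * exp (- x\<^sup>2) = exp (- x\<^sup>2 / 2)"
        unfolding exp_add[symmetric] by simp
      finally have "gamma_density \<nu> x \<le> ?c * exp (- x\<^sup>2 / 2)"
        by (simp add: gamma_density_def)
      then show ?thesis
        using True c by (simp add: ennreal_mult[symmetric] ennreal_leI)
    qed auto
  qed
  also have "\<dots> = ennreal ?c * ennreal (sqrt (2 * pi))"
    using nn_integral_gaussian[of 1 0] by (subst nn_integral_cmult) auto
  also have "\<dots> < \<infinity>"
    by (simp add: ennreal_mult_less_top)
  finally show "emeasure (gamma_measure \<nu>) (space (gamma_measure \<nu>)) \<noteq> \<infinity>"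
    by simp
qed

section \<open>Local doubling on admissible intervals\<close>

text \<open>Admissibility gives \<open>r \<le> x0\<close> and \<open>r * x0 \<le> 1\<close>: the
  first bounds \<open>y\<close> by \<open>3 * x0\<close>, the second bounds
  \<open>x0\<^sup>2 - y\<^sup>2\<close> by 4. Only an upper bound is possible here, as the doubled
  interval may reach down to 0, where the density vanishes.\<close>

lemma gamma_density_le_ball:
  assumes "\<nu> \<ge> 0" "admissible_ball 1 x0 r" "y > 0" "\<bar>y - x0\<bar> < 2 * r"
  shows "gamma_density \<nu> y \<le> 3 powr (2 * \<nu> + 1) * exp 4 * gamma_density \<nu> x0"
proof -
  have r: "0 < r" "r \<le> x0" "r * x0 \<le> 1"
    using assms(2) by (auto simp: admissible_ball_def m_fun_def field_simps)
  have G: "2 / Gamma (\<nu> + 1) \<ge> 0"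
    using assms by (intro divide_nonneg_pos Gamma_real_pos) auto
  have "y \<le> 3 * x0"
    using assms r by linarith
  then have p: "y powr (2 * \<nu> + 1) \<le> (3 * x0) powr (2 * \<nu> + 1)"
    using assms by (intro powr_mono2) auto
  have "x0\<^sup>2 - y\<^sup>2 \<le> 2 * x0 * (x0 - y)"
    using zero_le_power2[of "x0 - y"] by (simp add: power2_eq_square algebra_simps)
  also have "\<dots> \<le> 2 * x0 * (2 * r)"
    using assms r by (intro mult_left_mono) auto
  also have "\<dots> \<le> 4"
    using r by (simp add: mult.commute)
  finally have e: "exp (- y\<^sup>2) \<le> exp (4 + - x0\<^sup>2)"
    by simp
  have "gamma_density \<nu> y = 2 / Gamma (\<nu> + 1) * (y powr (2 * \<nu> + 1) * exp (- y\<^sup>2))"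
    by (simp add: gamma_density_def)
  also have "\<dots> \<le> 2 / Gamma (\<nu> + 1) * ((3 * x0) powr (2 * \<nu> + 1) * exp (4 + - x0\<^sup>2))"
    using p e G by (intro mult_left_mono mult_mono) auto
  also have "\<dots> = 3 powr (2 * \<nu> + 1) * exp 4 * gamma_density \<nu> x0"
    using r by (simp only: gamma_density_def powr_mult exp_add) simp
  finally show ?thesis .
qed

text \<open>To the right of the centre the power factor increases, and the Gaussian loses at most a
  factor \<open>exp 3\<close>, since \<open>2 * (r * x0) + r * r \<le> 3\<close>. The left half is
  avoided because it may reach 0.\<close>

lemma gamma_density_ge_ball:
  assumes "\<nu> \<ge> 0" "admissible_ball 1 x0 r" "x0 \<le> y" "y \<le> x0 + r"
  shows "exp (- 3) * gamma_density \<nu> x0 \<le> gamma_density \<nu> y"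
proof -
  have r: "0 < r" "r \<le> x0" "r * x0 \<le> 1" "r \<le> 1"
    using assms(2) by (auto simp: admissible_ball_def m_fun_def field_simps)
  have G: "2 / Gamma (\<nu> + 1) \<ge> 0"
    using assms by (intro divide_nonneg_pos Gamma_real_pos) auto
  have p: "x0 powr (2 * \<nu> + 1) \<le> y powr (2 * \<nu> + 1)"
    using assms r by (intro powr_mono2) auto
  have "y\<^sup>2 \<le> (x0 + r)\<^sup>2"
    using assms r by (intro power_mono) auto
  also have "\<dots> = x0\<^sup>2 + 2 * (r * x0) + r * r"
    by (simp add: power2_eq_square algebra_simps)
  also have "\<dots> \<le> x0\<^sup>2 + 3"
    using r mult_le_one[of r r] by simp
  finally have e: "exp (- 3 + - x0\<^sup>2) \<le> exp (- y\<^sup>2)"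
    by simp
  have "exp (- 3) * gamma_density \<nu> x0 = 2 / Gamma (\<nu> + 1) * (x0 powr (2 * \<nu> + 1) * exp (- 3 + - x0\<^sup>2))"
    by (simp only: gamma_density_def exp_add) simp
  also have "\<dots> \<le> 2 / Gamma (\<nu> + 1) * (y powr (2 * \<nu> + 1) * exp (- y\<^sup>2))"
    using p e G by (intro mult_left_mono mult_mono) auto
  also have "\<dots> = gamma_density \<nu> y"
    by (simp add: gamma_density_def)
  finally show ?thesis .
qed

lemma emeasure_gamma_measure:
  assumes "A \<in> sets borel" "A \<subseteq> {0<..}"
  shows "emeasure (gamma_measure \<nu>) A = (\<integral>\<^sup>+x. ennreal (gamma_density \<nu> x) * indicator A x \<partial>lborel)"
proof -
  have A: "A \<in> sets (gamma_measure \<nu>)"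
    using assms by (simp add: sets_gamma_measure_iff)
  have "emeasure (gamma_measure \<nu>) A = (\<integral>\<^sup>+x. indicator A x \<partial>gamma_measure \<nu>)"
    using A by simp
  also have "\<dots> = (\<integral>\<^sup>+x. ennreal (gamma_density \<nu> x) * indicator A x * indicator {0<..} x \<partial>lborel)"
    using A by (intro nn_integral_gamma_measure) simp
  also have "\<dots> = (\<integral>\<^sup>+x. ennreal (gamma_density \<nu> x) * indicator A x \<partial>lborel)"
    using assms by (intro nn_integral_cong) (auto simp: indicator_def)
  finally show ?thesis .
qed

lemma nn_integral_const_Ioo:
  fixes a b c :: real
  assumes "a \<le> b" "0 \<le> c"
  shows "(\<integral>\<^sup>+x. ennreal c * indicator {a<..<b} x \<partial>lborel) = ennreal (c * (b - a))"
  using assms by (subst nn_integral_cmult_indicator) (auto simp: ennreal_mult)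

lemma emeasure_pos_interval_ge:
  assumes "\<nu> \<ge> 0" "admissible_ball 1 x0 r"
  shows "ennreal (r * exp (- 3) * gamma_density \<nu> x0) \<le> emeasure (gamma_measure \<nu>) (pos_interval x0 r)"
proof -
  have r: "0 < r" "r \<le> x0"
    using assms(2) by (auto simp: admissible_ball_def)
  have "ennreal (r * exp (- 3) * gamma_density \<nu> x0) = (\<integral>\<^sup>+x. ennreal (exp (- 3) * gamma_density \<nu> x0) * indicator {x0<..<x0 + r} x \<partial>lborel)"
    using r gamma_density_nonneg[OF assms(1), of x0] by (subst nn_integral_const_Ioo) (auto simp: mult_ac)
  also have "\<dots> \<le> (\<integral>\<^sup>+x. ennreal (gamma_density \<nu> x) * indicator (pos_interval x0 r) x \<partial>lborel)"
    using r gamma_density_ge_ball[OF assms]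
    by (intro nn_integral_mono) (auto simp: indicator_def pos_interval_def intro!: ennreal_leI)
  also have "\<dots> = emeasure (gamma_measure \<nu>) (pos_interval x0 r)"
    by (rule emeasure_gamma_measure[symmetric]) (auto simp: pos_interval_def)
  finally show ?thesis .
qed

text \<open>The doubled interval has length at most \<open>4 * r\<close>, the right half of the
  original has length \<open>r\<close>, and the two density bounds contribute
  \<open>exp 4 * exp 3\<close>.\<close>

lemma emeasure_double_ball_le:
  assumes "\<nu> \<ge> 0" "admissible_ball 1 x0 r"
  shows "emeasure (gamma_measure \<nu>) {y. 0 < y \<and> \<bar>y - x0\<bar> < 2 * r}
    \<le> ennreal (4 * 3 powr (2 * \<nu> + 1) * exp 7) * emeasure (gamma_measure \<nu>) (pos_interval x0 r)"
proof -
  let ?A = "{y. 0 < y \<and> \<bar>y - x0\<bar> < 2 * r}"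
  let ?c = "3 powr (2 * \<nu> + 1) * exp 4"
  have r: "0 < r" "r \<le> x0"
    using assms(2) by (auto simp: admissible_ball_def)
  note g = gamma_density_nonneg[OF assms(1), of x0]
  have "emeasure (gamma_measure \<nu>) ?A = (\<integral>\<^sup>+x. ennreal (gamma_density \<nu> x) * indicator ?A x \<partial>lborel)"
    by (rule emeasure_gamma_measure) auto
  also have "\<dots> \<le> (\<integral>\<^sup>+x. ennreal (?c * gamma_density \<nu> x0) * indicator {x0 - 2 * r<..<x0 + 2 * r} x \<partial>lborel)"
  proof (rule nn_integral_mono)
    fix x
    show "ennreal (gamma_density \<nu> x) * indicator ?A x \<le> ennreal (?c * gamma_density \<nu> x0) * indicator {x0 - 2 * r<..<x0 + 2 * r} x"
    proof (cases "x \<in> ?A")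
      case True
      then have "x \<in> {x0 - 2 * r<..<x0 + 2 * r}" by auto
      then show ?thesis
        using True gamma_density_le_ball[OF assms, of x] by (simp add: ennreal_leI)
    qed auto
  qed
  also have "\<dots> = ennreal (4 * ?c * exp 3 * (r * exp (- 3) * gamma_density \<nu> x0))"
    using r g by (subst nn_integral_const_Ioo) (auto simp: exp_minus)
  also have "\<dots> = ennreal (4 * 3 powr (2 * \<nu> + 1) * exp 7) * ennreal (r * exp (- 3) * gamma_density \<nu> x0)"
    using r g by (simp add: ennreal_mult[symmetric] mult_ac flip: exp_add)
  also have "\<dots> \<le> ennreal (4 * 3 powr (2 * \<nu> + 1) * exp 7) * emeasure (gamma_measure \<nu>) (pos_interval x0 r)"
    by (intro mult_left_mono emeasure_pos_interval_ge assms) auto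
  finally show ?thesis .
qed

section \<open>The semigroup and its maximal operator\<close>

lemma laguerre_kernel_nonneg:
  assumes "\<nu> \<ge> 0" "t > 0" "x > 0" "y > 0"
  shows "laguerre_kernel \<nu> t x y \<ge> 0"
  unfolding laguerre_kernel_eq_heat[OF assms] using assms
  by (intro mult_nonneg_nonneg heat_nonneg less_imp_le[OF Gamma_real_pos]) auto

text \<open>Not uniform as \<open>t\<close> tends to 0, yet for fixed \<open>t\<close> and
  \<open>x\<close> it makes the kernel bounded in \<open>y\<close>; this gives absolute convergence
  and lets L1 limits pass through the semigroup pointwise.\<close>

lemma laguerre_kernel_le:
  assumes "\<nu> \<ge> 0" "t > 0" "x > 0" "y > 0"
  shows "laguerre_kernel \<nu> t x y \<le> exp (x\<^sup>2) * (1 - exp (- t)) powr (- (\<nu> + 1))"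
proof -
  have G: "Gamma (\<nu> + 1) > 0"
    using assms by (intro Gamma_real_pos) auto
  have "laguerre_kernel \<nu> t x y \<le> Gamma (\<nu> + 1) * exp (x\<^sup>2) * (inverse (Gamma (\<nu> + 1)) * (1 - exp (- t)) powr (- (\<nu> + 1)))"
    unfolding laguerre_kernel_eq_heat[OF assms] using assms G
    by (intro mult_left_mono heat_le_const) auto
  then show ?thesis
    using G by (simp add: field_simps)
qed

lemma continuous_on_heat:
  assumes "\<nu> \<ge> 0" "\<tau> > 0"
  shows "continuous_on S (heat \<nu> \<tau> x)"
  by (rule DERIV_continuous_on[OF DERIV_subset[OF has_real_derivative_heat[OF assms]]]) auto

lemma borel_measurable_laguerre_kernel:
  assumes "\<nu> \<ge> 0" "t > 0" "x > 0"
  shows "laguerre_kernel \<nu> t x \<in> borel_measurable (gamma_measure \<nu>)"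
proof -
  have "(\<lambda>y. Gamma (\<nu> + 1) * exp (x\<^sup>2) * heat \<nu> (1 - exp (- t)) x (exp (- t / 2) * y)) \<in> borel_measurable borel"
    using assms
    by (intro borel_measurable_continuous_onI continuous_intros continuous_on_compose2[OF continuous_on_heat]) auto
  then have "(\<lambda>y. Gamma (\<nu> + 1) * exp (x\<^sup>2) * heat \<nu> (1 - exp (- t)) x (exp (- t / 2) * y)) \<in> borel_measurable (gamma_measure \<nu>)"
    by (rule borel_measurable_gammaI)
  also have "?this \<longleftrightarrow> ?thesis"
    using laguerre_kernel_eq_heat[OF assms] by (intro measurable_cong) simp
  finally show ?thesis .
qed

lemma continuous_on_laguerre_kernel:
  assumes "\<nu> \<ge> 0" "t > 0" "y > 0"
  shows "continuous_on {0<..} (\<lambda>x. laguerre_kernel \<nu> t x y)"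
proof -
  have "continuous_on {0<..} (\<lambda>x. Gamma (\<nu> + 1) * exp (x\<^sup>2) * heat \<nu> (1 - exp (- t)) x (exp (- t / 2) * y))"
    unfolding heat_commute[where y = "exp (- t / 2) * y"] using assms by (intro continuous_intros continuous_on_heat) auto
  also have "?this \<longleftrightarrow> ?thesis"
    using laguerre_kernel_eq_heat[OF assms(1,2) _ assms(3)]
    by (intro continuous_on_cong) auto
  finally show ?thesis .
qed

text \<open>In the form \<open>laguerre_kernel_eq_heat'\<close> the density cancels
  \<open>exp (y\<^sup>2)\<close> and supplies the weight \<open>y powr (2 * \<nu> + 1)\<close>. What
  remains is dominated by a Gaussian centred at \<open>x'\<close>, whose integral depends neither on
  time nor on centre.\<close>

lemma laguerre_kernel_mass_bounded:
  assumes "\<nu> \<ge> 0"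
  obtains C where "C \<ge> 0"
    and "\<And>t x. t > 0 \<Longrightarrow> x > 0 \<Longrightarrow> (\<integral>\<^sup>+y. ennreal (laguerre_kernel \<nu> t x y) \<partial>gamma_measure \<nu>) \<le> ennreal C"
proof -
  obtain C where C: "C \<ge> 0" and heat: "\<And>\<tau> x y. \<tau> > 0 \<Longrightarrow> x > 0 \<Longrightarrow> y \<ge> 0 \<Longrightarrow>
      x powr (2 * \<nu> + 1) * heat \<nu> \<tau> x y \<le> C * \<tau> powr (- 1/2) * exp (- (x - y)\<^sup>2 / (2 * \<tau>))"
    using weighted_heat_le[OF assms] by metis
  have G: "Gamma (\<nu> + 1) > 0"
    using assms by (intro Gamma_real_pos) auto
  show ?thesis
  proof (rule that)
    show "2 * C * sqrt (2 * pi) \<ge> 0" using C by simp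
    fix t x :: real
    assume *: "t > 0" "x > 0"
    define \<tau> where "\<tau> = 1 - exp (- t)"
    define x' where "x' = exp (- t / 2) * x"
    have \<tau>: "\<tau> > 0" "x' > 0"
      using * by (auto simp: \<tau>_def x'_def)
    have "(\<integral>\<^sup>+y. ennreal (laguerre_kernel \<nu> t x y) \<partial>gamma_measure \<nu>) =
        (\<integral>\<^sup>+y. ennreal (gamma_density \<nu> y) * ennreal (laguerre_kernel \<nu> t x y) * indicator {0<..} y \<partial>lborel)"
      using borel_measurable_laguerre_kernel[OF assms *]
      by (intro nn_integral_gamma_measure measurable_compose[OF _ measurable_ennreal])
    also have "\<dots> \<le> (\<integral>\<^sup>+y. ennreal (2 * C) * ennreal (\<tau> powr (- 1/2) * exp (- (x' - y)\<^sup>2 / (2 * \<tau>))) \<partial>lborel)"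
    proof (rule nn_integral_mono)
      fix y :: real
      show "ennreal (gamma_density \<nu> y) * ennreal (laguerre_kernel \<nu> t x y) * indicator {0<..} y
          \<le> ennreal (2 * C) * ennreal (\<tau> powr (- 1/2) * exp (- (x' - y)\<^sup>2 / (2 * \<tau>)))"
      proof (cases "y > 0")
        case True
        have "gamma_density \<nu> y * laguerre_kernel \<nu> t x y =
            2 * (Gamma (\<nu> + 1) / Gamma (\<nu> + 1)) * (exp (- y\<^sup>2) * exp (y\<^sup>2)) * (y powr (2 * \<nu> + 1) * heat \<nu> \<tau> y x')"
          unfolding laguerre_kernel_eq_heat'[OF assms * True] gamma_density_def
            \<tau>_def[symmetric] x'_def[symmetric] heat_commute[of \<nu> \<tau> x' y]
          by (simp only: divide_inverse mult_ac)
        also have "\<dots> = 2 * (y powr (2 * \<nu> + 1) * heat \<nu> \<tau> y x')"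
          unfolding exp_add[symmetric] using G by simp
        also have "\<dots> \<le> 2 * (C * \<tau> powr (- 1/2) * exp (- (y - x')\<^sup>2 / (2 * \<tau>)))"
          using True \<tau> by (intro mult_left_mono heat) auto
        finally have "gamma_density \<nu> y * laguerre_kernel \<nu> t x y \<le> 2 * C * (\<tau> powr (- 1/2) * exp (- (x' - y)\<^sup>2 / (2 * \<tau>)))"
          by (simp only: mult_ac power2_commute)
        then show ?thesis
          using True C gamma_density_nonneg[OF assms] by (simp add: ennreal_mult'[symmetric] ennreal_leI)
      qed auto
    qed
    also have "\<dots> = ennreal (2 * C * sqrt (2 * pi))"
      using nn_integral_gaussian[OF \<tau>(1)] C by (subst nn_integral_cmult) (auto simp: ennreal_mult)
    finally show "(\<integral>\<^sup>+y. ennreal (laguerre_kernel \<nu> t x y) \<partial>gamma_measure \<nu>) \<le> ennreal (2 * C * sqrt (2 * pi))" .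
  qed
qed

section \<open>The semigroup on integrable functions: convergence, continuity, measurability, sup
  bounds\<close>

context
  fixes \<nu> :: real
  assumes \<nu>: "\<nu> \<ge> 0"
begin

lemma norm_kernel_mult_le:
  fixes f :: "real \<Rightarrow> complex"
  assumes "t > 0" "x > 0" "y > 0"
  shows "norm (complex_of_real (laguerre_kernel \<nu> t x y) * f y)
    \<le> exp (x\<^sup>2) * (1 - exp (- t)) powr (- (\<nu> + 1)) * norm (f y)"
  using laguerre_kernel_le[OF \<nu> assms] laguerre_kernel_nonneg[OF \<nu> assms]
  by (simp add: norm_mult mult_right_mono)

lemma integrable_kernel_mult:
  fixes f :: "real \<Rightarrow> complex"
  assumes "t > 0" "x > 0" "integrable (gamma_measure \<nu>) f"
  shows "integrable (gamma_measure \<nu>) (\<lambda>y. complex_of_real (laguerre_kernel \<nu> t x y) * f y)"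
proof (rule Bochner_Integration.integrable_bound)
  show "integrable (gamma_measure \<nu>) (\<lambda>y. exp (x\<^sup>2) * (1 - exp (- t)) powr (- (\<nu> + 1)) * norm (f y))"
    using assms by auto
  note borel_measurable_laguerre_kernel[OF \<nu> assms(1,2), measurable]
    borel_measurable_integrable[OF assms(3), measurable]
  show "(\<lambda>y. complex_of_real (laguerre_kernel \<nu> t x y) * f y) \<in> borel_measurable (gamma_measure \<nu>)"
    by measurable
  show "AE y in gamma_measure \<nu>. norm (complex_of_real (laguerre_kernel \<nu> t x y) * f y) \<le>
      norm (exp (x\<^sup>2) * (1 - exp (- t)) powr (- (\<nu> + 1)) * norm (f y))"
    using norm_kernel_mult_le[OF assms(1,2), of _ f] by (intro AE_I2) (simp add: abs_mult)
qed

lemma norm_semigroup_le_L1: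
  fixes f :: "real \<Rightarrow> complex"
  assumes "t > 0" "x > 0" "integrable (gamma_measure \<nu>) f"
  shows "ennreal (norm (laguerre_semigroup \<nu> t f x)) \<le>
    ennreal (exp (x\<^sup>2) * (1 - exp (- t)) powr (- (\<nu> + 1))) * (\<integral>\<^sup>+y. ennreal (norm (f y)) \<partial>gamma_measure \<nu>)"
proof -
  note borel_measurable_integrable[OF assms(3), measurable]
  have "ennreal (norm (laguerre_semigroup \<nu> t f x)) \<le>
      (\<integral>\<^sup>+y. ennreal (norm (complex_of_real (laguerre_kernel \<nu> t x y) * f y)) \<partial>gamma_measure \<nu>)"
    unfolding laguerre_semigroup_def by (rule integral_norm_bound_ennreal[OF integrable_kernel_mult[OF assms]])
  also have "\<dots> \<le> (\<integral>\<^sup>+y. ennreal (exp (x\<^sup>2) * (1 - exp (- t)) powr (- (\<nu> + 1))) * ennreal (norm (f y)) \<partial>gamma_measure \<nu>)"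
    using norm_kernel_mult_le[OF assms(1,2), of _ f]
    by (intro nn_integral_mono) (auto simp: ennreal_mult[symmetric] intro!: ennreal_leI)
  also have "\<dots> = ennreal (exp (x\<^sup>2) * (1 - exp (- t)) powr (- (\<nu> + 1))) * (\<integral>\<^sup>+y. ennreal (norm (f y)) \<partial>gamma_measure \<nu>)"
    by (rule nn_integral_cmult) measurable
  finally show ?thesis .
qed

text \<open>Dominated convergence along sequences: a convergent sequence is bounded by some
  \<open>R\<close>, so \<open>exp (R\<^sup>2)\<close> controls the growing factor in the kernel
  bound.\<close>

lemma continuous_on_laguerre_semigroup:
  fixes f :: "real \<Rightarrow> complex"
  assumes "t > 0" "integrable (gamma_measure \<nu>) f"
  shows "continuous_on {0<..} (laguerre_semigroup \<nu> t f)"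
  unfolding continuous_on_sequentially
proof (intro allI ballI impI)
  fix X :: "nat \<Rightarrow> real" and a
  assume a: "a \<in> {0<..}" and "(\<forall>n. X n \<in> {0<..}) \<and> X \<longlonglongrightarrow> a"
  then have X: "\<And>n. X n > 0" "X \<longlonglongrightarrow> a"
    by auto
  from X(2) have "Bseq X"
    by (intro convergent_imp_Bseq convergentI)
  then obtain R where R: "\<And>n. \<bar>X n\<bar> \<le> R"
    by (auto simp: Bseq_def)
  let ?M = "(1 - exp (- t)) powr (- (\<nu> + 1))"
  note borel_measurable_integrable[OF assms(2), measurable]
  show "(laguerre_semigroup \<nu> t f \<circ> X) \<longlonglongrightarrow> laguerre_semigroup \<nu> t f a"
    unfolding laguerre_semigroup_def comp_def
  proof (rule integral_dominated_convergence)
    show "(\<lambda>y. complex_of_real (laguerre_kernel \<nu> t a y) * f y) \<in> borel_measurable (gamma_measure \<nu>)"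
      using integrable_kernel_mult[OF assms(1) _ assms(2), of a] a by auto
    show "(\<lambda>y. complex_of_real (laguerre_kernel \<nu> t (X n) y) * f y) \<in> borel_measurable (gamma_measure \<nu>)" for n
      using integrable_kernel_mult[OF assms(1) X(1) assms(2)] by auto
    show "integrable (gamma_measure \<nu>) (\<lambda>y. exp (R\<^sup>2) * ?M * norm (f y))"
      using assms by auto
    show "AE y in gamma_measure \<nu>. (\<lambda>n. complex_of_real (laguerre_kernel \<nu> t (X n) y) * f y)
        \<longlonglongrightarrow> complex_of_real (laguerre_kernel \<nu> t a y) * f y"
    proof (intro AE_I2)
      fix y assume "y \<in> space (gamma_measure \<nu>)"
      then have "continuous_on {0<..} (\<lambda>x. laguerre_kernel \<nu> t x y)"
        using continuous_on_laguerre_kernel[OF \<nu> assms(1)] by simp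
      then have "(\<lambda>n. laguerre_kernel \<nu> t (X n) y) \<longlonglongrightarrow> laguerre_kernel \<nu> t a y"
        using X a by (intro continuous_on_tendsto_compose[of "{0<..}" "\<lambda>x. laguerre_kernel \<nu> t x y"]) auto
      then show "(\<lambda>n. complex_of_real (laguerre_kernel \<nu> t (X n) y) * f y)
          \<longlonglongrightarrow> complex_of_real (laguerre_kernel \<nu> t a y) * f y"
        by (intro tendsto_intros)
    qed
    show "AE y in gamma_measure \<nu>. norm (complex_of_real (laguerre_kernel \<nu> t (X n) y) * f y) \<le> exp (R\<^sup>2) * ?M * norm (f y)" for n
    proof (intro AE_I2)
      fix y assume y: "y \<in> space (gamma_measure \<nu>)"
      have "(X n)\<^sup>2 \<le> R\<^sup>2"
        using R[of n] by (metis abs_ge_zero power2_abs power_mono)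
      have "norm (complex_of_real (laguerre_kernel \<nu> t (X n) y) * f y) \<le> exp ((X n)\<^sup>2) * ?M * norm (f y)"
        using y by (intro norm_kernel_mult_le assms X) simp
      also have "\<dots> \<le> exp (R\<^sup>2) * ?M * norm (f y)"
        using \<open>(X n)\<^sup>2 \<le> R\<^sup>2\<close> by (intro mult_right_mono) auto
      finally show "norm (complex_of_real (laguerre_kernel \<nu> t (X n) y) * f y) \<le> exp (R\<^sup>2) * ?M * norm (f y)" .
    qed
  qed
qed

lemma borel_measurable_truncated_maximal:
  fixes f :: "real \<Rightarrow> complex"
  assumes "integrable (gamma_measure \<nu>) f"
  shows "truncated_maximal \<nu> f \<in> borel_measurable (gamma_measure \<nu>)"
proof (rule borel_measurableI_greater)
  \<comment> \<open>For fixed \<open>t\<close> the semigroup is continuous in \<open>x\<close>, so superlevel sets of the uncountable supremum are open.\<close>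
  fix a :: ennreal
  let ?U = "\<lambda>t. ({0<..} \<inter> (\<lambda>x. (m_fun x)\<^sup>2) -` {t<..}) \<inter>
      ({0<..} \<inter> (\<lambda>x. ennreal (norm (laguerre_semigroup \<nu> t f x))) -` {a<..})"
  have "open (?U t)" if "t > 0" for t
  proof (rule open_Int)
    have "continuous_on {0<..} (\<lambda>x. (m_fun x)\<^sup>2)"
      unfolding m_fun_def by (intro continuous_intros) auto
    then show "open ({0<..} \<inter> (\<lambda>x. (m_fun x)\<^sup>2) -` {t<..})"
      by (rule continuous_open_preimage) auto
    have "continuous_on {0<..} (\<lambda>x. ennreal (norm (laguerre_semigroup \<nu> t f x)))"
      by (intro continuous_on_ennreal continuous_on_norm continuous_on_laguerre_semigroup that assms)
    then show "open ({0<..} \<inter> (\<lambda>x. ennreal (norm (laguerre_semigroup \<nu> t f x))) -` {a<..})"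
      by (rule continuous_open_preimage) auto
  qed
  then have "open (\<Union>t\<in>{0<..}. ?U t)"
    by (intro open_UN) auto
  then have "(\<Union>t\<in>{0<..}. ?U t) \<in> sets (gamma_measure \<nu>)"
    unfolding sets_gamma_measure_iff by (auto intro: borel_open)
  also have "(\<Union>t\<in>{0<..}. ?U t) = {x \<in> space (gamma_measure \<nu>). a < truncated_maximal \<nu> f x}"
    by (auto simp: truncated_maximal_def less_SUP_iff)
  finally show "{x \<in> space (gamma_measure \<nu>). a < truncated_maximal \<nu> f x} \<in> sets (gamma_measure \<nu>)" .
qed

text \<open>Positivity of the kernel turns the uniform mass bound into a sup bound. The size of
  \<open>b\<close> is assumed almost everywhere because the norm of an atom is an essential
  supremum.\<close>

lemma truncated_maximal_le_Linf:
  fixes b :: "real \<Rightarrow> complex"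
  assumes C: "\<And>t x. t > 0 \<Longrightarrow> x > 0 \<Longrightarrow> (\<integral>\<^sup>+y. ennreal (laguerre_kernel \<nu> t x y) \<partial>gamma_measure \<nu>) \<le> ennreal C"
    and "C \<ge> 0" "M \<ge> 0" "x > 0"
    and b: "integrable (gamma_measure \<nu>) b" "AE y in gamma_measure \<nu>. norm (b y) \<le> M"
  shows "truncated_maximal \<nu> b x \<le> ennreal (C * M)"
  unfolding truncated_maximal_def
proof (rule SUP_least)
  fix t assume "t \<in> {0<..<(m_fun x)\<^sup>2}"
  then have t: "t > 0" by simp
  have "ennreal (norm (laguerre_semigroup \<nu> t b x)) \<le>
      (\<integral>\<^sup>+y. ennreal (norm (complex_of_real (laguerre_kernel \<nu> t x y) * b y)) \<partial>gamma_measure \<nu>)"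
    unfolding laguerre_semigroup_def
    by (rule integral_norm_bound_ennreal[OF integrable_kernel_mult[OF t \<open>x > 0\<close> b(1)]])
  also have "\<dots> \<le> (\<integral>\<^sup>+y. ennreal M * ennreal (laguerre_kernel \<nu> t x y) \<partial>gamma_measure \<nu>)"
  proof (rule nn_integral_mono_AE)
    show "AE y in gamma_measure \<nu>. ennreal (norm (complex_of_real (laguerre_kernel \<nu> t x y) * b y))
        \<le> ennreal M * ennreal (laguerre_kernel \<nu> t x y)"
      using b(2)
    proof (rule AE_mp, intro AE_I2 impI)
      fix y assume y: "y \<in> space (gamma_measure \<nu>)" and "norm (b y) \<le> M"
      have K: "laguerre_kernel \<nu> t x y \<ge> 0"
        using y by (intro laguerre_kernel_nonneg[OF \<nu> t \<open>x > 0\<close>]) simp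
      have "norm (complex_of_real (laguerre_kernel \<nu> t x y) * b y) = norm (b y) * laguerre_kernel \<nu> t x y"
        using K by (simp add: norm_mult)
      also have "\<dots> \<le> M * laguerre_kernel \<nu> t x y"
        using K \<open>norm (b y) \<le> M\<close> by (intro mult_right_mono)
      finally show "ennreal (norm (complex_of_real (laguerre_kernel \<nu> t x y) * b y))
        \<le> ennreal M * ennreal (laguerre_kernel \<nu> t x y)"
        using \<open>M \<ge> 0\<close> K by (simp add: ennreal_mult[symmetric] ennreal_leI)
    qed
  qed
  also have "\<dots> = ennreal M * (\<integral>\<^sup>+y. ennreal (laguerre_kernel \<nu> t x y) \<partial>gamma_measure \<nu>)"
    using borel_measurable_laguerre_kernel[OF \<nu> t \<open>x > 0\<close>] by (intro nn_integral_cmult) simp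
  also have "\<dots> \<le> ennreal M * ennreal C"
    by (intro mult_left_mono C t) (use assms in auto)
  finally show "ennreal (norm (laguerre_semigroup \<nu> t b x)) \<le> ennreal (C * M)"
    using assms by (simp add: ennreal_mult mult.commute)
qed

end

section \<open>Atoms\<close>

context
  fixes \<nu> :: real
  assumes \<nu>: "\<nu> \<ge> 0"
begin

text \<open>Since \<open>1 / \<infinity>\<close> is 0, the exponent is -1 and the size condition is
  a reciprocal of the measure. That measure is positive by \<open>emeasure_pos_interval_ge\<close>,
  so it can be cancelled later.\<close>

lemma atom_Linf_bound:
  assumes "b \<in> borel_measurable (gamma_measure \<nu>)" "admissible_ball 1 x0 r"
    and "Lq_norm (gamma_measure \<nu>) \<infinity> b
      \<le> ennreal (measure (gamma_measure \<nu>) (pos_interval x0 r) powr (enn2real (1 / \<infinity>) - 1))"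
  shows "measure (gamma_measure \<nu>) (pos_interval x0 r) > 0"
    and "AE y in gamma_measure \<nu>. norm (b y) \<le> 1 / measure (gamma_measure \<nu>) (pos_interval x0 r)"
proof -
  let ?m = "measure (gamma_measure \<nu>) (pos_interval x0 r)"
  interpret finite_measure "gamma_measure \<nu>"
    by (rule finite_measure_gamma[OF \<nu>])
  have r: "r > 0" "x0 > 0"
    using assms(2) by (auto simp: admissible_ball_def)
  have "0 < r * exp (- 3) * gamma_density \<nu> x0"
    using r \<nu> by (auto simp: gamma_density_def intro!: mult_pos_pos divide_pos_pos Gamma_real_pos)
  then have "0 < ennreal (r * exp (- 3) * gamma_density \<nu> x0)"
    by simp
  also have "\<dots> \<le> ennreal ?m"
    using emeasure_pos_interval_ge[OF \<nu> assms(2)] by (simp add: emeasure_eq_measure)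
  finally show m: "?m > 0"
    by simp
  have "esssup (gamma_measure \<nu>) (\<lambda>y. ennreal (norm (b y))) \<le> ennreal (1 / ?m)"
    using assms(3) m by (simp add: Lq_norm_def powr_minus_divide)
  with esssup_AE[where f = "\<lambda>y. ennreal (norm (b y))" and M = "gamma_measure \<nu>"]
  show "AE y in gamma_measure \<nu>. norm (b y) \<le> 1 / ?m"
  proof (elim AE_mp, intro AE_I2 impI)
    fix y assume "ennreal (norm (b y)) \<le> esssup (gamma_measure \<nu>) (\<lambda>y. ennreal (norm (b y)))"
    then have "ennreal (norm (b y)) \<le> ennreal (1 / ?m)"
      using \<open>esssup _ _ \<le> _\<close> by (rule order_trans)
    then show "norm (b y) \<le> 1 / ?m"
      using m by (simp add: ennreal_le_iff)
  qed
qed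

lemma integrable_atom:
  assumes "is_atom 1 \<infinity> \<nu> b"
  shows "integrable (gamma_measure \<nu>) b"
proof -
  interpret finite_measure "gamma_measure \<nu>"
    by (rule finite_measure_gamma[OF \<nu>])
  have meas: "b \<in> borel_measurable (gamma_measure \<nu>)"
    using assms by (simp add: is_atom_def)
  have "\<exists>B. AE y in gamma_measure \<nu>. norm (b y) \<le> B"
  proof (cases "\<forall>x>0. b x = 1")
    case True
    then have "AE y in gamma_measure \<nu>. norm (b y) \<le> 1"
      by (intro AE_I2) simp
    then show ?thesis ..
  next
    case False
    then show ?thesis
      using assms atom_Linf_bound(2)[OF meas] unfolding is_atom_def by blast
  qed
  then show ?thesis
    using meas integrable_const_bound by blast
qed

text \<open>Because \<open>b\<close> has mean zero, the kernel at \<open>x0\<close> may be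
  subtracted under the integral; as \<open>b\<close> has L1 norm at most 1, only the kernel
  difference on its support counts. The weight in the hypothesis is the density up to a constant, so
  the conclusion bounds the integrand with respect to Lebesgue measure.\<close>

lemma truncated_maximal_far:
  fixes b :: "real \<Rightarrow> complex"
  assumes C: "\<And>t y. 0 < t \<Longrightarrow> t < (m_fun x)\<^sup>2 \<Longrightarrow> y > 0 \<Longrightarrow> \<bar>y - x0\<bar> \<le> r \<Longrightarrow>
        x powr (2 * \<nu> + 1) * exp (- x\<^sup>2) * \<bar>laguerre_kernel \<nu> t x y - laguerre_kernel \<nu> t x x0\<bar> \<le> K"
    and pos: "x > 0" "x0 > 0" "K \<ge> 0"
    and b: "integrable (gamma_measure \<nu>) b" "(\<integral>y. b y \<partial>gamma_measure \<nu>) = 0"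
      "{y. 0 < y \<and> b y \<noteq> 0} \<subseteq> pos_interval x0 r"
    and L1: "(\<integral>\<^sup>+y. ennreal (norm (b y)) \<partial>gamma_measure \<nu>) \<le> 1"
  shows "ennreal (gamma_density \<nu> x) * truncated_maximal \<nu> b x \<le> ennreal (2 / Gamma (\<nu> + 1) * K)"
proof -
  define p where "p = x powr (2 * \<nu> + 1) * exp (- x\<^sup>2)"
  have p: "p > 0"
    using pos by (simp add: p_def)
  have G: "Gamma (\<nu> + 1) > 0"
    using \<nu> by (intro Gamma_real_pos) auto
  note borel_measurable_integrable[OF b(1), measurable]
  have "truncated_maximal \<nu> b x \<le> ennreal (K / p)"
    unfolding truncated_maximal_def
  proof (rule SUP_least)
    fix t assume "t \<in> {0<..<(m_fun x)\<^sup>2}"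
    then have t: "t > 0" "t < (m_fun x)\<^sup>2" by auto
    let ?k = "laguerre_kernel \<nu> t x" and ?k' = "laguerre_kernel \<nu> t x x0"
    have int: "integrable (gamma_measure \<nu>) (\<lambda>y. complex_of_real (?k y) * b y - complex_of_real ?k' * b y)"
      using integrable_kernel_mult[OF \<nu> t(1) pos(1) b(1)] b(1) by auto
    \<comment> \<open>The subtracted integral is a multiple of the mean of \<open>b\<close>, hence
      0.\<close>
    have "laguerre_semigroup \<nu> t b x = (\<integral>y. complex_of_real (?k y) * b y \<partial>gamma_measure \<nu>) -
        (\<integral>y. complex_of_real ?k' * b y \<partial>gamma_measure \<nu>)"
      using b by (simp add: laguerre_semigroup_def)
    also have "\<dots> = (\<integral>y. complex_of_real (?k y) * b y - complex_of_real ?k' * b y \<partial>gamma_measure \<nu>)"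
      using integrable_kernel_mult[OF \<nu> t(1) pos(1) b(1)] b(1)
      by (intro Bochner_Integration.integral_diff[symmetric]) auto
    finally have "ennreal (norm (laguerre_semigroup \<nu> t b x)) \<le>
        (\<integral>\<^sup>+y. ennreal (norm (complex_of_real (?k y) * b y - complex_of_real ?k' * b y)) \<partial>gamma_measure \<nu>)"
      using integral_norm_bound_ennreal[OF int] by simp
    also have "\<dots> \<le> (\<integral>\<^sup>+y. ennreal (K / p) * ennreal (norm (b y)) \<partial>gamma_measure \<nu>)"
    proof (rule nn_integral_mono)
      fix y assume "y \<in> space (gamma_measure \<nu>)"
      then have y: "y > 0" by simp
      have "norm (complex_of_real (?k y) * b y - complex_of_real ?k' * b y) = \<bar>?k y - ?k'\<bar> * norm (b y)"
        by (metis left_diff_distrib norm_mult norm_of_real of_real_diff)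
      also have "\<dots> \<le> K / p * norm (b y)"
      proof (cases "b y = 0")
        case False
        with b(3) y have "y \<in> pos_interval x0 r" by auto
        then have "\<bar>y - x0\<bar> \<le> r" by (auto simp: pos_interval_def)
        from C[OF t y this] have "\<bar>?k y - ?k'\<bar> \<le> K / p"
          using p by (simp add: p_def field_simps)
        then show ?thesis
          by (intro mult_right_mono) auto
      qed simp
      finally show "ennreal (norm (complex_of_real (?k y) * b y - complex_of_real ?k' * b y)) \<le> ennreal (K / p) * ennreal (norm (b y))"
        using p pos by (simp add: ennreal_mult[symmetric] ennreal_leI)
    qed
    also have "\<dots> = ennreal (K / p) * (\<integral>\<^sup>+y. ennreal (norm (b y)) \<partial>gamma_measure \<nu>)"
      by (rule nn_integral_cmult) measurable
    also have "\<dots> \<le> ennreal (K / p) * 1"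
      by (intro mult_left_mono L1) auto
    finally show "ennreal (norm (laguerre_semigroup \<nu> t b x)) \<le> ennreal (K / p)"
      by simp
  qed
  then have "ennreal (gamma_density \<nu> x) * truncated_maximal \<nu> b x \<le> ennreal (gamma_density \<nu> x) * ennreal (K / p)"
    by (intro mult_left_mono) auto
  also have "\<dots> = ennreal (gamma_density \<nu> x * (K / p))"
    using p pos gamma_density_nonneg[OF \<nu>, of x] by (subst ennreal_mult) auto
  also have "gamma_density \<nu> x * (K / p) = 2 / Gamma (\<nu> + 1) * p * (K / p)"
    by (simp add: gamma_density_def p_def)
  also have "\<dots> = 2 / Gamma (\<nu> + 1) * K"
    using p by simp
  finally show ?thesis .
qed

text \<open>Split at distance \<open>2 * r\<close> from \<open>x0\<close>. Nearby, the height
  \<open>C0 / m\<close> meets a set of measure at most \<open>C2 * m\<close>, so \<open>m\<close>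
  cancels; far away, cancellation gives the scale-free integral of
  \<open>r / (x - x0)\<^sup>2\<close>. The constant atom is covered by the sup bound and finiteness
  of the measure.\<close>

lemma truncated_maximal_atom_bounded:
  obtains C where "C \<ge> 0"
    and "\<And>b. is_atom 1 \<infinity> \<nu> b \<Longrightarrow> (\<integral>\<^sup>+x. truncated_maximal \<nu> b x \<partial>gamma_measure \<nu>) \<le> ennreal C"
proof -
  let ?\<gamma> = "gamma_measure \<nu>"
  interpret finite_measure ?\<gamma>
    by (rule finite_measure_gamma[OF \<nu>])
  obtain C0 where C0: "C0 \<ge> 0" "\<And>t x. t > 0 \<Longrightarrow> x > 0 \<Longrightarrow>
      (\<integral>\<^sup>+y. ennreal (laguerre_kernel \<nu> t x y) \<partial>?\<gamma>) \<le> ennreal C0"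
    using laguerre_kernel_mass_bounded[OF \<nu>] by metis
  obtain C1 where C1: "C1 \<ge> 0" "\<And>t x y x0 r. 0 < t \<Longrightarrow> t < (m_fun x)\<^sup>2 \<Longrightarrow> x > 0 \<Longrightarrow> y > 0 \<Longrightarrow>
      x0 > 0 \<Longrightarrow> r > 0 \<Longrightarrow> \<bar>y - x0\<bar> \<le> r \<Longrightarrow> \<bar>x - x0\<bar> \<ge> 2 * r \<Longrightarrow>
      x powr (2 * \<nu> + 1) * exp (- x\<^sup>2) * \<bar>laguerre_kernel \<nu> t x y - laguerre_kernel \<nu> t x x0\<bar>
        \<le> C1 * (r / (x - x0)\<^sup>2)"
    using kernel_difference_bound[OF \<nu>] by metis
  define C2 where "C2 = 4 * 3 powr (2 * \<nu> + 1) * exp (7 :: real)"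
  define C3 where "C3 = 2 / Gamma (\<nu> + 1) * C1"
  have C2: "C2 \<ge> 0"
    by (simp add: C2_def)
  have C3: "C3 \<ge> 0"
    unfolding C3_def using \<nu> C1(1) by (intro mult_nonneg_nonneg divide_nonneg_pos Gamma_real_pos) auto
  \<comment> \<open>The summands belong to the constant atom, the near part and the far part, in
    this order.\<close>
  define C where "C = C0 * measure ?\<gamma> {0<..} + C0 * C2 + C3"
  show ?thesis
  proof (rule that)
    show "C \<ge> 0"
      using C0 C2 C3 by (simp add: C_def)
    fix b assume atom: "is_atom 1 \<infinity> \<nu> b"
    note int = integrable_atom[OF atom]
    have meas: "b \<in> borel_measurable ?\<gamma>"
      using int by simp
    show "(\<integral>\<^sup>+x. truncated_maximal \<nu> b x \<partial>?\<gamma>) \<le> ennreal C"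
    proof (cases "\<forall>x>0. b x = 1")
      case True
      have "(\<integral>\<^sup>+x. truncated_maximal \<nu> b x \<partial>?\<gamma>) \<le> (\<integral>\<^sup>+x. ennreal C0 \<partial>?\<gamma>)"
      proof (rule nn_integral_mono)
        fix x assume "x \<in> space ?\<gamma>"
        moreover have "AE y in ?\<gamma>. norm (b y) \<le> 1"
          using True by (intro AE_I2) simp
        ultimately show "truncated_maximal \<nu> b x \<le> ennreal C0"
          using truncated_maximal_le_Linf[OF \<nu> C0(2) C0(1) zero_le_one, of x b] int by simp
      qed
      also have "\<dots> = ennreal (C0 * measure ?\<gamma> {0<..})"
        using C0 by (simp add: emeasure_eq_measure ennreal_mult)
      also have "\<dots> \<le> ennreal C"
        using C0 C2 C3 by (intro ennreal_leI) (simp add: C_def)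
      finally show ?thesis .
    next
      case False
      then obtain x0 r where ball: "admissible_ball 1 x0 r"
        and supp: "{y. 0 < y \<and> b y \<noteq> 0} \<subseteq> pos_interval x0 r"
        and norm: "Lq_norm ?\<gamma> \<infinity> b \<le> ennreal (measure ?\<gamma> (pos_interval x0 r) powr (enn2real (1 / \<infinity>) - 1))"
        and canc: "(\<integral>y. b y \<partial>?\<gamma>) = 0"
        using atom by (auto simp: is_atom_def)
      have r: "r > 0" "x0 > 0"
        using ball by (auto simp: admissible_ball_def)
      define m where "m = measure ?\<gamma> (pos_interval x0 r)"
      have m: "m > 0" and M: "AE y in ?\<gamma>. norm (b y) \<le> 1 / m"
        using atom_Linf_bound[OF meas ball norm] by (auto simp: m_def)
      have I: "pos_interval x0 r \<in> sets ?\<gamma>"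
        by (auto simp: sets_gamma_measure_iff pos_interval_def)
      \<comment> \<open>Height \<open>1 / m\<close> on a set of measure \<open>m\<close>.\<close>
      have L1: "(\<integral>\<^sup>+y. ennreal (norm (b y)) \<partial>?\<gamma>) \<le> 1"
      proof -
        have "(\<integral>\<^sup>+y. ennreal (norm (b y)) \<partial>?\<gamma>) \<le> (\<integral>\<^sup>+y. ennreal (1 / m) * indicator (pos_interval x0 r) y \<partial>?\<gamma>)"
        proof (rule nn_integral_mono_AE)
          show "AE y in ?\<gamma>. ennreal (norm (b y)) \<le> ennreal (1 / m) * indicator (pos_interval x0 r) y"
            using M
          proof (rule AE_mp, intro AE_I2 impI)
            fix y assume "y \<in> space ?\<gamma>" "norm (b y) \<le> 1 / m"
            then show "ennreal (norm (b y)) \<le> ennreal (1 / m) * indicator (pos_interval x0 r) y"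
              using supp by (cases "b y = 0") (auto simp: ennreal_leI)
          qed
        qed
        also have "\<dots> = ennreal (1 / m) * ennreal m"
          using I by (simp add: nn_integral_cmult_indicator emeasure_eq_measure m_def)
        also have "\<dots> = 1"
          using m by (simp flip: ennreal_mult)
        finally show ?thesis .
      qed
      let ?A = "{x. 0 < x \<and> \<bar>x - x0\<bar> < 2 * r}" and ?F = "{x. \<bar>x - x0\<bar> \<ge> 2 * r}"
      have A: "?A \<in> sets ?\<gamma>"
        by (auto simp: sets_gamma_measure_iff)
      have "(\<integral>\<^sup>+x. truncated_maximal \<nu> b x \<partial>?\<gamma>) =
          (\<integral>\<^sup>+x. ennreal (gamma_density \<nu> x) * truncated_maximal \<nu> b x * indicator {0<..} x \<partial>lborel)"
        by (rule nn_integral_gamma_measure[OF borel_measurable_truncated_maximal[OF \<nu> int]])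
      \<comment> \<open>The far bound lives in Lebesgue measure; the near part keeps the density so
        that it can be read as a measure of \<open>?A\<close> again.\<close>
      also have "\<dots> \<le> (\<integral>\<^sup>+x. ennreal (C0 * (1 / m)) * (ennreal (gamma_density \<nu> x) * indicator ?A x) +
          ennreal C3 * (ennreal (r / (x - x0)\<^sup>2) * indicator ?F x) \<partial>lborel)"
      proof (rule nn_integral_mono)
        fix x :: real
        show "ennreal (gamma_density \<nu> x) * truncated_maximal \<nu> b x * indicator {0<..} x \<le>
          ennreal (C0 * (1 / m)) * (ennreal (gamma_density \<nu> x) * indicator ?A x) +
          ennreal C3 * (ennreal (r / (x - x0)\<^sup>2) * indicator ?F x)"
        proof (cases "x > 0")
          case x: True
          show ?thesis
          proof (cases "x \<in> ?F")
            case True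
            have "ennreal (gamma_density \<nu> x) * truncated_maximal \<nu> b x \<le>
                ennreal (2 / Gamma (\<nu> + 1) * (C1 * (r / (x - x0)\<^sup>2)))"
              using True r x C1 int canc supp L1 by (intro truncated_maximal_far) auto
            also have "\<dots> = ennreal C3 * ennreal (r / (x - x0)\<^sup>2)"
              unfolding mult.assoc[symmetric] C3_def[symmetric] using C3 r by (simp add: ennreal_mult[symmetric])
            finally show ?thesis
              using True x by simp
          next
            case False
            have "truncated_maximal \<nu> b x \<le> ennreal (C0 * (1 / m))"
              using m by (intro truncated_maximal_le_Linf[OF \<nu> C0(2,1) _ x int M]) auto
            then have "ennreal (gamma_density \<nu> x) * truncated_maximal \<nu> b x \<le>
                ennreal (gamma_density \<nu> x) * ennreal (C0 * (1 / m))"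
              by (intro mult_left_mono) auto
            then show ?thesis
              using False x by (simp add: mult.commute)
          qed
        qed simp
      qed
      also have "\<dots> = ennreal (C0 * (1 / m)) * (\<integral>\<^sup>+x. ennreal (gamma_density \<nu> x) * indicator ?A x \<partial>lborel) +
          ennreal C3 * (\<integral>\<^sup>+x. ennreal (r / (x - x0)\<^sup>2) * indicator ?F x \<partial>lborel)"
      proof -
        have [measurable]: "?A \<in> sets borel" "?F \<in> sets borel"
          by measurable
        show ?thesis
          by (subst nn_integral_add, measurable, subst (1 2) nn_integral_cmult, measurable)
      qed
      also have "\<dots> \<le> ennreal (C0 * (1 / m)) * (ennreal C2 * ennreal m) + ennreal C3 * 1"
      proof (intro add_mono mult_left_mono)
        have "(\<integral>\<^sup>+x. ennreal (gamma_density \<nu> x) * indicator ?A x \<partial>lborel) = emeasure ?\<gamma> ?A"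
          by (rule emeasure_gamma_measure[symmetric]) auto
        also have "\<dots> \<le> ennreal C2 * ennreal m"
          using emeasure_double_ball_le[OF \<nu> ball] by (simp add: C2_def m_def emeasure_eq_measure)
        finally show "(\<integral>\<^sup>+x. ennreal (gamma_density \<nu> x) * indicator ?A x \<partial>lborel) \<le> ennreal C2 * ennreal m" .
        show "(\<integral>\<^sup>+x. ennreal (r / (x - x0)\<^sup>2) * indicator ?F x \<partial>lborel) \<le> 1"
          by (rule nn_integral_inverse_square_far[OF r(1)])
      qed auto
      also have "\<dots> = ennreal (C0 * C2 + C3)"
      proof -
        have "ennreal (C0 * (1 / m)) * (ennreal C2 * ennreal m) = ennreal (C0 * (1 / m) * (C2 * m))"
          unfolding ennreal_mult[OF C2 less_imp_le[OF m], symmetric]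
          using C0(1) C2 m by (intro ennreal_mult[symmetric]) auto
        also have "C0 * (1 / m) * (C2 * m) = C0 * C2"
          using m by simp
        finally show ?thesis
          using C0 C2 C3 by simp
      qed
      also have "\<dots> \<le> ennreal C"
        using C0 by (intro ennreal_leI) (simp add: C_def)
      finally show ?thesis .
    qed
  qed
qed

section \<open>Passage from atoms to atomic series\<close>

text \<open>A bound on atoms alone does not control infinite sums. Here the kernel is bounded in
  \<open>y\<close>, so L1 convergence of the partial sums carries over to the semigroup at the point
  \<open>x\<close>. The constant \<open>?M\<close> depends on \<open>t\<close> and \<open>x\<close>,
  which is harmless as the limit is taken for fixed \<open>t\<close>, before the supremum.\<close>

lemma truncated_maximal_atomic_sum_le:
  assumes f: "integrable (gamma_measure \<nu>) f" and rep: "atomic_rep 1 \<infinity> \<nu> f c b" and "x > 0"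
  shows "truncated_maximal \<nu> f x \<le> (\<Sum>j. ennreal (norm (c j)) * truncated_maximal \<nu> (b j) x)"
    (is "_ \<le> ?S")
  unfolding truncated_maximal_def[of \<nu> f]
proof (rule SUP_least)
  fix t assume t: "t \<in> {0<..<(m_fun x)\<^sup>2}"
  then have t0: "t > 0" by simp
  let ?e = "\<lambda>n. \<integral>\<^sup>+y. ennreal (norm (f y - (\<Sum>j<n. c j * b j y))) \<partial>gamma_measure \<nu>"
  let ?M = "ennreal (exp (x\<^sup>2) * (1 - exp (- t)) powr (- (\<nu> + 1)))"
  let ?W = "\<lambda>g. laguerre_semigroup \<nu> t g x"
  have atoms: "is_atom 1 \<infinity> \<nu> (b j)" for j
    using rep by (simp add: atomic_rep_def)
  note b = integrable_atom[OF atoms]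
  have S: "integrable (gamma_measure \<nu>) (\<lambda>y. \<Sum>j<n. c j * b j y)" for n
    using b by auto
  have "(\<lambda>n. ?M * ?e n + ?S) \<longlonglongrightarrow> ?M * 0 + ?S"
    using rep by (intro tendsto_add tendsto_const ennreal_tendsto_cmult) (auto simp: atomic_rep_def)
  then have "(\<lambda>n. ?M * ?e n + ?S) \<longlonglongrightarrow> ?S"
    by simp
  \<comment> \<open>Split \<open>f\<close> into the remainder, paid for by the L1 error, and a
    finite partial sum, estimated termwise and enlarged to the whole series.\<close>
  moreover have "ennreal (norm (?W f)) \<le> ?M * ?e n + ?S" for n
  proof -
    note k = integrable_kernel_mult[OF \<nu> t0 \<open>x > 0\<close>]
    have "?W (\<lambda>y. f y - (\<Sum>j<n. c j * b j y)) = ?W f - ?W (\<lambda>y. \<Sum>j<n. c j * b j y)"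
      unfolding laguerre_semigroup_def right_diff_distrib
      by (rule Bochner_Integration.integral_diff[OF k[OF f] k[OF S]])
    moreover have "?W (\<lambda>y. \<Sum>j<n. c j * b j y) = (\<Sum>j<n. c j * ?W (b j))"
    proof -
      have "?W (\<lambda>y. \<Sum>j<n. c j * b j y) =
          (\<integral>y. (\<Sum>j<n. c j * (complex_of_real (laguerre_kernel \<nu> t x y) * b j y)) \<partial>gamma_measure \<nu>)"
        unfolding laguerre_semigroup_def by (simp add: sum_distrib_left mult_ac)
      also have "\<dots> = (\<Sum>j<n. \<integral>y. c j * (complex_of_real (laguerre_kernel \<nu> t x y) * b j y) \<partial>gamma_measure \<nu>)"
        by (rule Bochner_Integration.integral_sum) (use k[OF b] in auto)
      also have "\<dots> = (\<Sum>j<n. c j * ?W (b j))"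
        unfolding laguerre_semigroup_def by simp
      finally show ?thesis .
    qed
    ultimately have W: "?W f = ?W (\<lambda>y. f y - (\<Sum>j<n. c j * b j y)) + (\<Sum>j<n. c j * ?W (b j))"
      by simp
    have "norm (?W f) \<le> norm (?W (\<lambda>y. f y - (\<Sum>j<n. c j * b j y))) + (\<Sum>j<n. norm (c j) * norm (?W (b j)))"
      unfolding W norm_mult[symmetric]
      by (rule order_trans[OF norm_triangle_ineq add_left_mono[OF norm_sum]])
    then have "ennreal (norm (?W f)) \<le> ennreal (norm (?W (\<lambda>y. f y - (\<Sum>j<n. c j * b j y))) + (\<Sum>j<n. norm (c j) * norm (?W (b j))))"
      by (rule ennreal_leI)
    also have "\<dots> = ennreal (norm (?W (\<lambda>y. f y - (\<Sum>j<n. c j * b j y)))) + (\<Sum>j<n. ennreal (norm (c j)) * ennreal (norm (?W (b j))))"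
      by (subst ennreal_plus) (auto simp: sum_nonneg ennreal_mult sum_ennreal[symmetric] simp del: sum_ennreal)
    also have "\<dots> \<le> ?M * ?e n + ?S"
    proof (rule add_mono)
      show "ennreal (norm (?W (\<lambda>y. f y - (\<Sum>j<n. c j * b j y)))) \<le> ?M * ?e n"
        using f S by (intro norm_semigroup_le_L1[OF \<nu> t0 \<open>x > 0\<close>]) auto
      have "(\<Sum>j<n. ennreal (norm (c j)) * ennreal (norm (?W (b j)))) \<le>
          (\<Sum>j<n. ennreal (norm (c j)) * truncated_maximal \<nu> (b j) x)"
        unfolding truncated_maximal_def using t by (intro sum_mono mult_left_mono SUP_upper) auto
      also have "\<dots> \<le> ?S"
        by (rule sum_le_suminf) auto
      finally show "(\<Sum>j<n. ennreal (norm (c j)) * ennreal (norm (?W (b j)))) \<le> ?S" .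
    qed
    finally show ?thesis .
  qed
  ultimately show "ennreal (norm (?W f)) \<le> ?S"
    by (intro LIMSEQ_le_const) auto
qed

end

section \<open>Infimum over atomic representations\<close>

theorem theorem1p6:
  fixes \<alpha> :: real
  assumes "\<alpha> \<ge> 0"
  shows "\<exists>C\<ge>0. \<forall>f\<in>hardy_space \<alpha>.
           truncated_maximal \<alpha> f \<in> borel_measurable (gamma_measure \<alpha>) \<and>
           (\<integral>\<^sup>+ x. truncated_maximal \<alpha> f x \<partial>gamma_measure \<alpha>) \<le> ennreal (C * hardy_norm \<alpha> f)"
proof -
  obtain C0 where C0: "C0 \<ge> 0" "\<And>b. is_atom 1 \<infinity> \<alpha> b \<Longrightarrow>
      (\<integral>\<^sup>+x. truncated_maximal \<alpha> b x \<partial>gamma_measure \<alpha>) \<le> ennreal C0"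
    using truncated_maximal_atom_bounded[OF assms] by metis
  \<comment> \<open>Adding 1 makes the constant strictly positive, so that it can be divided out
    when passing to the infimum.\<close>
  define C where "C = C0 + 1"
  have C: "C > 0"
    using C0 by (simp add: C_def)
  have atom: "(\<integral>\<^sup>+x. truncated_maximal \<alpha> b x \<partial>gamma_measure \<alpha>) \<le> ennreal C" if "is_atom 1 \<infinity> \<alpha> b" for b
    using C0(2)[OF that] by (rule order_trans) (simp add: C_def ennreal_leI)
  have "truncated_maximal \<alpha> f \<in> borel_measurable (gamma_measure \<alpha>) \<and>
           (\<integral>\<^sup>+ x. truncated_maximal \<alpha> f x \<partial>gamma_measure \<alpha>) \<le> ennreal (C * hardy_norm \<alpha> f)"
    if "f \<in> hardy_space \<alpha>" for f
  proof
    have f: "integrable (gamma_measure \<alpha>) f" and ex: "\<exists>c b. atomic_rep 1 \<infinity> \<alpha> f c b"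
      using that by (auto simp: hardy_space_def hardy_space_aq_def)
    show "truncated_maximal \<alpha> f \<in> borel_measurable (gamma_measure \<alpha>)"
      by (rule borel_measurable_truncated_maximal[OF assms f])
    let ?I = "\<integral>\<^sup>+ x. truncated_maximal \<alpha> f x \<partial>gamma_measure \<alpha>"
    let ?R = "{(\<Sum>j. norm (c j)) | c. \<exists>b. atomic_rep 1 \<infinity> \<alpha> f c b}"
    have bound: "?I \<le> ennreal (C * (\<Sum>j. norm (c j)))" if rep: "atomic_rep 1 \<infinity> \<alpha> f c b" for c b
    proof -
      have atoms: "is_atom 1 \<infinity> \<alpha> (b j)" for j
        using rep by (simp add: atomic_rep_def)
      have summ: "summable (\<lambda>j. norm (c j))"
        using rep by (simp add: atomic_rep_def)
      have meas [measurable]: "truncated_maximal \<alpha> (b j) \<in> borel_measurable (gamma_measure \<alpha>)" for j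
        by (rule borel_measurable_truncated_maximal[OF assms integrable_atom[OF assms atoms]])
      have "?I \<le> (\<integral>\<^sup>+x. (\<Sum>j. ennreal (norm (c j)) * truncated_maximal \<alpha> (b j) x) \<partial>gamma_measure \<alpha>)"
        by (rule nn_integral_mono) (simp add: truncated_maximal_atomic_sum_le[OF assms f rep])
      also have "\<dots> = (\<Sum>j. \<integral>\<^sup>+x. ennreal (norm (c j)) * truncated_maximal \<alpha> (b j) x \<partial>gamma_measure \<alpha>)"
        by (rule nn_integral_suminf) measurable
      also have "\<dots> = (\<Sum>j. ennreal (norm (c j)) * (\<integral>\<^sup>+x. truncated_maximal \<alpha> (b j) x \<partial>gamma_measure \<alpha>))"
        by (intro suminf_cong nn_integral_cmult meas)
      also have "\<dots> \<le> (\<Sum>j. ennreal (C * norm (c j)))"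
        using C atom[OF atoms] by (intro suminf_le) (auto simp: ennreal_mult mult.commute[of "ennreal C"] intro: mult_left_mono)
      also have "\<dots> = ennreal (\<Sum>j. C * norm (c j))"
        using C summ by (intro suminf_ennreal2) (auto intro: summable_mult)
      also have "(\<Sum>j. C * norm (c j)) = C * (\<Sum>j. norm (c j))"
        by (rule suminf_mult[OF summ])
      finally show ?thesis .
    qed
    obtain c b where "atomic_rep 1 \<infinity> \<alpha> f c b"
      using ex by blast
    \<comment> \<open>A single representation already makes the integral finite, hence a real number
      comparable with the real-valued Hardy norm.\<close>
    from le_less_trans[OF bound[OF this] ennreal_less_top] obtain v where v: "?I = ennreal v" "v \<ge> 0"
      by (cases ?I) auto
    have "v / C \<le> s" if s_in: "s \<in> ?R" for s
    proof -
      obtain c b where s: "s = (\<Sum>j. norm (c j))" and rep: "atomic_rep 1 \<infinity> \<alpha> f c b"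
        using s_in by blast
      have "s \<ge> 0"
        unfolding s using rep by (intro suminf_nonneg) (auto simp: atomic_rep_def)
      then have "v \<le> C * s"
        using bound[OF rep] C by (simp add: v s[symmetric] ennreal_le_iff)
      then show ?thesis
        using C by (simp add: field_simps)
    qed
    \<comment> \<open>A lower bound passes to the real \<open>Inf\<close> because the set of costs
      is nonempty, which is membership in the Hardy space.\<close>
    then have "v / C \<le> hardy_norm \<alpha> f"
      unfolding hardy_norm_def hardy_norm_aq_def using ex by (intro cInf_greatest) auto
    then have "v \<le> C * hardy_norm \<alpha> f"
      using C by (simp add: field_simps)
    then show "?I \<le> ennreal (C * hardy_norm \<alpha> f)"
      unfolding v by (rule ennreal_leI)
  qed
  then show ?thesis
    using C by (intro exI[of _ C]) auto
qed

end
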